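(* Let $X$ be a d-space and let $g,h:X\to X$ be d-maps such that $h\circ g$ and $h$ are $0$-inessential. Then $g$ is $0$-inessential. Likewise, if $h\circ g$ and $h$ are coherently $0$-inessential, then $g$ is coherently $0$-inessential.
   Context: Let $I=[0,1]$. A d-space is a topological space $X$ together with a subspace $\vec{P}(X)\subset X^I$ (the d-paths) that contains the constant paths and is closed under concatenation and under non-decreasing continuous reparametrizations $p:I\to I$. A d-map $f:X\to Y$ between d-spaces is a continuous map with $f\circ p\in\vec{P}(Y)$ for all $p\in\vec{P}(X)$. $\vec{P}(X)_x^y$ is the subspace of d-paths from $x$ to $y$; $x\preceq y$ means $\vec{P}(X)_x^y\neq\emptyset$; $\vec{X^2}=\{(x,y)\in X^2\mid x\preceq y\}$. The trace space $\vec{T}(X)$ is the quotient of $\vec{P}(X)$ (quotient topology) under the equivalence relation generated by $p\sim p\circ\varphi$ for continuous non-decreasing $\varphi:I\to I$ with $\varphi(0)=0,\varphi(1)=1$; $\vec{T}(X)_x^y$ is the fibre over $(x,y)\in\vec{X^2}$ of the end-point map $\vec{e}_X:\vec{T}(X)\to\vec{X^2}$. A d-map $f:X\to Y$ induces $\vec{T}(f):\vec{T}(X)\to\vec{T}(Y)$, $\sigma\mapsto f\circ\sigma$, and restrictions $\vec{T}(f)_{x_1}^{x_2}:\vec{T}(X)_{x_1}^{x_2}\to\vec{T}(Y)_{fx_1}^{fx_2}$. A d-map $f$ is path space preserving (psp) if $\vec{T}(f)_{x_1}^{x_2}$ is a weak homotopy equivalence for all $(x_1,x_2)\in\vec{X^2}$.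 The neutral interval, denoted $I$, is $[0,1]$ with only constant d-paths; products carry the product d-structure. A neutral d-homotopy is a d-map $H:X\times I\to X$. It is psp if every $H_t=H(-,t)$ is psp. It is coherently psp if it is psp and, moreover, the map $\bigsqcup_t\vec{T}(H_t):\vec{T}(X)\times I\to(\vec{H^2})^*\vec{T}(X)$ over $\vec{X^2}\times I$ has a continuous fibre homotopy inverse (over $\vec{X^2}\times I$), where $(\vec{H^2})^*\vec{T}(X)$ is the pullback of $\vec{e}_X$ along $\vec{H^2}:\vec{X^2}\times I\to\vec{X^2}$, $(x_1,x_2,t)\mapsto(H_tx_1,H_tx_2)$. A d-map $f:X\to X$ is (coherently) $0$-inessential if there is a (coherently) psp neutral d-homotopy $H$ with $H_0=id_X$ and $H_1=f$. *)

theory Defs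
  imports "HOL-Analysis.Analysis"
begin

section \<open>d-spaces and d-maps\<close>

text \<open>Paths are functions on the reals that are extensional on the unit interval, so that equality
  of paths is equality on the interval; composites are cut down by \<open>restrict\<close> accordingly.\<close>

record 'a dstruct =
  dtop :: "'a topology"
  dpaths :: "(real \<Rightarrow> 'a) set"

definition ext_path :: "'a topology \<Rightarrow> (real \<Rightarrow> 'a) \<Rightarrow> bool" where
  "ext_path T p \<longleftrightarrow> pathin T p \<and> p \<in> extensional {0..1}"

definition path_concat :: "(real \<Rightarrow> 'a) \<Rightarrow> (real \<Rightarrow> 'a) \<Rightarrow> real \<Rightarrow> 'a" where
  "path_concat p q = restrict (\<lambda>t. if t \<le> 1/2 then p (2 * t) else q (2 * t - 1)) {0..1}"

definition d_space :: "'a dstruct \<Rightarrow> bool" where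
  "d_space X \<longleftrightarrow>
     (\<forall>p \<in> dpaths X. ext_path (dtop X) p) \<and>
     (\<forall>x \<in> topspace (dtop X). restrict (\<lambda>_. x) {0..1} \<in> dpaths X) \<and>
     (\<forall>p \<in> dpaths X. \<forall>q \<in> dpaths X. p 1 = q 0 \<longrightarrow> path_concat p q \<in> dpaths X) \<and>
     (\<forall>p \<in> dpaths X. \<forall>\<phi>. continuous_on {0..1} \<phi> \<and> \<phi> ` {0..1} \<subseteq> {0..1} \<and> mono_on {0..1} \<phi>
        \<longrightarrow> restrict (p \<circ> \<phi>) {0..1} \<in> dpaths X)"

definition dmap :: "'a dstruct \<Rightarrow> 'b dstruct \<Rightarrow> ('a \<Rightarrow> 'b) \<Rightarrow> bool" where
  "dmap X Y f \<longleftrightarrow> continuous_map (dtop X) (dtop Y) f \<and>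
     (\<forall>p \<in> dpaths X. restrict (f \<circ> p) {0..1} \<in> dpaths Y)"

definition dpaths_between :: "'a dstruct \<Rightarrow> 'a \<Rightarrow> 'a \<Rightarrow> (real \<Rightarrow> 'a) set" where
  "dpaths_between X x y = {p \<in> dpaths X. p 0 = x \<and> p 1 = y}"

definition reach_pairs :: "'a dstruct \<Rightarrow> ('a \<times> 'a) set" where
  "reach_pairs X = {(x, y). x \<in> topspace (dtop X) \<and> y \<in> topspace (dtop X) \<and>
                            dpaths_between X x y \<noteq> {}}"

definition dprod :: "'a dstruct \<Rightarrow> 'b dstruct \<Rightarrow> ('a \<times> 'b) dstruct" where
  "dprod X Y = \<lparr> dtop = prod_topology (dtop X) (dtop Y),
     dpaths = {p. ext_path (prod_topology (dtop X) (dtop Y)) p \<and>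
                  restrict (fst \<circ> p) {0..1} \<in> dpaths X \<and> restrict (snd \<circ> p) {0..1} \<in> dpaths Y} \<rparr>"

definition neutral_interval :: "real dstruct" where
  "neutral_interval = \<lparr> dtop = top_of_set {0..1}, dpaths = {restrict (\<lambda>_. s) {0..1} | s. s \<in> {0..1}} \<rparr>"

section \<open>Path spaces and trace spaces\<close>

text \<open>The compact-open topology on the space of all paths in \<open>T\<close>.\<close>

definition compact_open_paths :: "'a topology \<Rightarrow> (real \<Rightarrow> 'a) topology" where
  "compact_open_paths T = topology_generated_by
     {{p. ext_path T p \<and> p ` K \<subseteq> U} | K U. compact K \<and> K \<subseteq> {0..1} \<and> openin T U}"

definition dpath_space :: "'a dstruct \<Rightarrow> (real \<Rightarrow> 'a) topology" where
  "dpath_space X = subtopology (compact_open_paths (dtop X)) (dpaths X)"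

definition quotient_topology :: "'a topology \<Rightarrow> ('a \<Rightarrow> 'b) \<Rightarrow> 'b topology" where
  "quotient_topology T q =
     topology (\<lambda>U. U \<subseteq> q ` topspace T \<and> openin T {x \<in> topspace T. q x \<in> U})"

lemma openin_quotient_topology:
  "openin (quotient_topology T q) U \<longleftrightarrow>
     U \<subseteq> q ` topspace T \<and> openin T {x \<in> topspace T. q x \<in> U}"
proof -
  have int: "{x \<in> topspace T. q x \<in> S \<inter> V} =
      {x \<in> topspace T. q x \<in> S} \<inter> {x \<in> topspace T. q x \<in> V}" for S V by auto
  have un: "{x \<in> topspace T. q x \<in> \<Union>\<K>} = (\<Union>S\<in>\<K>. {x \<in> topspace T. q x \<in> S})" for \<K> by auto
  have "istopology (\<lambda>U. U \<subseteq> q ` topspace T \<and> openin T {x \<in> topspace T. q x \<in> U})"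
    unfolding istopology_def int un by (auto simp del: Collect_mem_eq)
  then show ?thesis by (simp only: quotient_topology_def topology_inverse')
qed

lemma topspace_quotient_topology: "topspace (quotient_topology T q) = q ` topspace T"
proof
  show "topspace (quotient_topology T q) \<subseteq> q ` topspace T"
    by (rule openin_quotient_topology[THEN iffD1, OF openin_topspace, THEN conjunct1])
  have "{x \<in> topspace T. q x \<in> q ` topspace T} = topspace T" by auto
  then have "openin (quotient_topology T q) (q ` topspace T)"
    by (simp add: openin_quotient_topology)
  then show "q ` topspace T \<subseteq> topspace (quotient_topology T q)" by (rule openin_subset)
qed

lemma quotient_map_quotient_topology: "quotient_map T (quotient_topology T q) q"
  by (auto simp: quotient_map_def openin_quotient_topology topspace_quotient_topology)

definition reparam :: "'a dstruct \<Rightarrow> (real \<Rightarrow> 'a) \<Rightarrow> (real \<Rightarrow> 'a) \<Rightarrow> bool" where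
  "reparam X p q \<longleftrightarrow> p \<in> dpaths X \<and>
     (\<exists>\<phi>. continuous_on {0..1} \<phi> \<and> mono_on {0..1} \<phi> \<and> \<phi> 0 = 0 \<and> \<phi> 1 = 1 \<and>
          q = restrict (p \<circ> \<phi>) {0..1})"

definition dtrace :: "'a dstruct \<Rightarrow> (real \<Rightarrow> 'a) \<Rightarrow> (real \<Rightarrow> 'a) set" where
  "dtrace X p = {q. equivclp (reparam X) p q}"

definition trace_space :: "'a dstruct \<Rightarrow> (real \<Rightarrow> 'a) set topology" where
  "trace_space X = quotient_topology (dpath_space X) (dtrace X)"

text \<open>All paths in a trace have the same end points, so the image below is a singleton.\<close>

definition endpoints :: "(real \<Rightarrow> 'a) set \<Rightarrow> 'a \<times> 'a" where
  "endpoints \<sigma> = the_elem ((\<lambda>p. (p 0, p 1)) ` \<sigma>)"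

definition trace_fibre :: "'a dstruct \<Rightarrow> 'a \<Rightarrow> 'a \<Rightarrow> (real \<Rightarrow> 'a) set topology" where
  "trace_fibre X x y = subtopology (trace_space X) {\<sigma>. endpoints \<sigma> = (x, y)}"

text \<open>The induced map sends the trace of \<open>p\<close> to the trace of \<open>f \<circ> p\<close>. For a d-map \<open>f\<close> the traces in
  the union below all coincide.\<close>

definition trace_map :: "'b dstruct \<Rightarrow> ('a \<Rightarrow> 'b) \<Rightarrow> (real \<Rightarrow> 'a) set \<Rightarrow> (real \<Rightarrow> 'b) set" where
  "trace_map Y f \<sigma> = (\<Union>p\<in>\<sigma>. dtrace Y (restrict (f \<circ> p) {0..1}))"

section \<open>Weak homotopy equivalences\<close>

definition cube :: "nat \<Rightarrow> (nat \<Rightarrow> real) topology" where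
  "cube n = product_topology (\<lambda>_. top_of_set {0..1}) {..<n}"

definition cube_boundary :: "nat \<Rightarrow> (nat \<Rightarrow> real) set" where
  "cube_boundary n = {x \<in> topspace (cube n). \<exists>i<n. x i = 0 \<or> x i = 1}"

definition cube_homotopic ::
    "nat \<Rightarrow> 'a topology \<Rightarrow> 'a \<Rightarrow> ((nat \<Rightarrow> real) \<Rightarrow> 'a) \<Rightarrow> ((nat \<Rightarrow> real) \<Rightarrow> 'a) \<Rightarrow> bool" where
  "cube_homotopic n T a =
     homotopic_with (\<lambda>k. \<forall>x \<in> cube_boundary n. k x = a) (cube n) T"

text \<open>The underlying set of the \<open>n\<close>-th homotopy group of \<open>T\<close> at \<open>a\<close>.\<close>

definition homotopy_classes :: "nat \<Rightarrow> 'a topology \<Rightarrow> 'a \<Rightarrow> ((nat \<Rightarrow> real) \<Rightarrow> 'a) set set" where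
  "homotopy_classes n T a =
     {Collect (cube_homotopic n T a p) | p.
        continuous_map (cube n) T p \<and> (\<forall>x \<in> cube_boundary n. p x = a)}"

definition homotopy_classes_map ::
    "nat \<Rightarrow> 'b topology \<Rightarrow> 'b \<Rightarrow> ('a \<Rightarrow> 'b) \<Rightarrow> ((nat \<Rightarrow> real) \<Rightarrow> 'a) set \<Rightarrow> ((nat \<Rightarrow> real) \<Rightarrow> 'b) set" where
  "homotopy_classes_map n T b f C = (\<Union>p\<in>C. Collect (cube_homotopic n T b (f \<circ> p)))"

definition path_components_map :: "'b topology \<Rightarrow> ('a \<Rightarrow> 'b) \<Rightarrow> 'a set \<Rightarrow> 'b set" where
  "path_components_map T f C = (\<Union>x\<in>C. Collect (path_component_of T (f x)))"

text \<open>For \<open>n \<ge> 1\<close> the induced map on homotopy classes is always a group homomorphism, so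
  that bijectivity says that it is an isomorphism of homotopy groups.\<close>

definition weak_homotopy_equivalence :: "'a topology \<Rightarrow> 'b topology \<Rightarrow> ('a \<Rightarrow> 'b) \<Rightarrow> bool" where
  "weak_homotopy_equivalence S T f \<longleftrightarrow>
     continuous_map S T f \<and>
     bij_betw (path_components_map T f) (path_components_of S) (path_components_of T) \<and>
     (\<forall>n\<ge>1. \<forall>a \<in> topspace S.
        bij_betw (homotopy_classes_map n T (f a) f)
          (homotopy_classes n S a) (homotopy_classes n T (f a)))"

section \<open>Fibre homotopy equivalences\<close>

definition fibre_map ::
    "'e topology \<Rightarrow> ('e \<Rightarrow> 'b) \<Rightarrow> 'f topology \<Rightarrow> ('f \<Rightarrow> 'b) \<Rightarrow> ('e \<Rightarrow> 'f) \<Rightarrow> bool" where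
  "fibre_map E p E' p' f \<longleftrightarrow> continuous_map E E' f \<and> (\<forall>e \<in> topspace E. p' (f e) = p e)"

definition fibre_homotopic ::
    "'e topology \<Rightarrow> ('e \<Rightarrow> 'b) \<Rightarrow> 'f topology \<Rightarrow> ('f \<Rightarrow> 'b) \<Rightarrow> ('e \<Rightarrow> 'f) \<Rightarrow> ('e \<Rightarrow> 'f) \<Rightarrow> bool" where
  "fibre_homotopic E p E' p' = homotopic_with (\<lambda>k. \<forall>e \<in> topspace E. p' (k e) = p e) E E'"

definition fibre_homotopy_equivalence ::
    "'e topology \<Rightarrow> ('e \<Rightarrow> 'b) \<Rightarrow> 'f topology \<Rightarrow> ('f \<Rightarrow> 'b) \<Rightarrow> ('e \<Rightarrow> 'f) \<Rightarrow> bool" where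
  "fibre_homotopy_equivalence E p E' p' f \<longleftrightarrow>
     fibre_map E p E' p' f \<and>
     (\<exists>g. fibre_map E' p' E p g \<and>
          fibre_homotopic E p E p (g \<circ> f) id \<and> fibre_homotopic E' p' E' p' (f \<circ> g) id)"

text \<open>The pullback of \<open>p\<close>, defined on \<open>E\<close>, along \<open>f\<close>, defined on \<open>B\<close>. Its projection to \<open>B\<close> is \<open>fst\<close>.\<close>

definition pullback_space ::
    "'b topology \<Rightarrow> ('b \<Rightarrow> 'c) \<Rightarrow> 'e topology \<Rightarrow> ('e \<Rightarrow> 'c) \<Rightarrow> ('b \<times> 'e) topology" where
  "pullback_space B f E p = subtopology (prod_topology B E) {(b, e). f b = p e}"

section \<open>Path space preserving homotopies and inessential maps\<close>

definition psp :: "'a dstruct \<Rightarrow> 'b dstruct \<Rightarrow> ('a \<Rightarrow> 'b) \<Rightarrow> bool" where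
  "psp X Y f \<longleftrightarrow> dmap X Y f \<and>
     (\<forall>(x1, x2) \<in> reach_pairs X.
        weak_homotopy_equivalence (trace_fibre X x1 x2) (trace_fibre Y (f x1) (f x2)) (trace_map Y f))"

definition neutral_dhomotopy :: "'a dstruct \<Rightarrow> ('a \<times> real \<Rightarrow> 'a) \<Rightarrow> bool" where
  "neutral_dhomotopy X H \<longleftrightarrow> dmap (dprod X neutral_interval) X H"

definition psp_homotopy :: "'a dstruct \<Rightarrow> ('a \<times> real \<Rightarrow> 'a) \<Rightarrow> bool" where
  "psp_homotopy X H \<longleftrightarrow> neutral_dhomotopy X H \<and> (\<forall>t \<in> {0..1}. psp X X (\<lambda>x. H (x, t)))"

definition reach_base :: "'a dstruct \<Rightarrow> (('a \<times> 'a) \<times> real) topology" where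
  "reach_base X = prod_topology
     (subtopology (prod_topology (dtop X) (dtop X)) (reach_pairs X)) (top_of_set {0..1})"

definition homotopy_square :: "('a \<times> real \<Rightarrow> 'a) \<Rightarrow> ('a \<times> 'a) \<times> real \<Rightarrow> 'a \<times> 'a" where
  "homotopy_square H = (\<lambda>((x1, x2), t). (H (x1, t), H (x2, t)))"

definition coherently_psp_homotopy :: "'a dstruct \<Rightarrow> ('a \<times> real \<Rightarrow> 'a) \<Rightarrow> bool" where
  "coherently_psp_homotopy X H \<longleftrightarrow> psp_homotopy X H \<and>
     fibre_homotopy_equivalence
       (prod_topology (trace_space X) (top_of_set {0..1})) (\<lambda>(\<sigma>, t). (endpoints \<sigma>, t))
       (pullback_space (reach_base X) (homotopy_square H) (trace_space X) endpoints) fst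
       (\<lambda>(\<sigma>, t). ((endpoints \<sigma>, t), trace_map X (\<lambda>x. H (x, t)) \<sigma>))"

definition zero_inessential :: "'a dstruct \<Rightarrow> ('a \<Rightarrow> 'a) \<Rightarrow> bool" where
  "zero_inessential X f \<longleftrightarrow> dmap X X f \<and>
     (\<exists>H. psp_homotopy X H \<and> (\<forall>x \<in> topspace (dtop X). H (x, 0) = x \<and> H (x, 1) = f x))"

definition coherently_zero_inessential :: "'a dstruct \<Rightarrow> ('a \<Rightarrow> 'a) \<Rightarrow> bool" where
  "coherently_zero_inessential X f \<longleftrightarrow> dmap X X f \<and>
     (\<exists>H. coherently_psp_homotopy X H \<and>
          (\<forall>x \<in> topspace (dtop X). H (x, 0) = x \<and> H (x, 1) = f x))"

end

theory Submission
  imports Defs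
begin

text \<open>
  Let \<open>K\<close> be a homotopy from the identity to \<open>h \<circ> g\<close> and \<open>L\<close> one from the identity to \<open>h\<close>. Then \<open>K\<close> followed by
  the reverse of \<open>L\<^sub>t \<circ> g\<close>, which runs from \<open>h \<circ> g\<close> to \<open>g\<close>, is a neutral d-homotopy from the identity to \<open>g\<close>.
  It is psp by two-out-of-three: on trace spaces \<open>h = L\<^sub>1\<close> and \<open>h \<circ> g = K\<^sub>1\<close> induce weak equivalences, so \<open>g\<close> does,
  and therefore every \<open>L\<^sub>t \<circ> g\<close> does (\<open>psp_comp_iff\<close>).

  For coherence the weak equivalences are replaced by one fibre homotopy equivalence, over the base of all triples
  \<open>(x, y, t)\<close> with \<open>x \<preceq> y\<close>. The same argument applies over either of the two parts of the time interval, because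
  fibre homotopy equivalences satisfy two-out-of-three
  (\<open>fibre_homotopy_equivalence_cancel_left\<close>) and pull back along maps of the base
  (\<open>coherent_pullback_equivalence\<close>). The inverses obtained over the two parts need not agree where the parts meet,
  and the end point map need not be a fibration, so they cannot be adjusted by lifting homotopies. Instead the concatenated homotopy rests at
  \<open>h \<circ> g\<close> for some time. This makes the two parts overlap, and over the overlap the inverses are
  homotopic and can be blended into a single map \<open>\<psi>\<close>.

  The composites of \<open>\<psi>\<close> with the original map are homotopic to the identity over each part, but perhaps not globally,
  since no coherence between the chosen homotopies is known. What helps is
  \<open>locally_identity_imp_fibre_homotopy_equivalence\<close>: such a composite differs from the identity by a
  loop of self-maps that is spread over the overlap, and the reversed loop gives an inverse. Hence the original map has
  one-sided inverses on both sides, which suffices (\<open>fibre_homotopy_equivalence_glue\<close>).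
\<close>

section \<open>Continuity of maps built from pieces and homotopies\<close>

lemma continuous_map_comp:
  assumes "continuous_map X Y f" and "continuous_map Y Z g"
  shows "continuous_map X Z (\<lambda>x. g (f x))"
  using continuous_map_compose[OF assms] by (simp add: o_def)

lemma continuous_map_unit_interval:
  assumes "continuous_map Z euclideanreal w" and "\<And>z. z \<in> topspace Z \<Longrightarrow> 0 \<le> w z \<and> w z \<le> 1"
  shows "continuous_map Z (top_of_set {0..1}) w"
  using assms by (auto simp: continuous_map_in_subtopology)

lemma continuous_map_homotopy_at:
  assumes "continuous_map (prod_topology (top_of_set {0..1::real}) D) W h"
    and "continuous_map Z euclideanreal w" and "\<And>z. z \<in> topspace Z \<Longrightarrow> 0 \<le> w z \<and> w z \<le> 1"
    and "continuous_map Z D m"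
  shows "continuous_map Z W (\<lambda>z. h (w z, m z))"
  by (rule continuous_map_comp[OF _ assms(1)])
     (intro continuous_map_pairedI continuous_map_unit_interval assms)

lemma continuous_map_glue_le:
  fixes \<tau> :: "'a \<Rightarrow> real"
  assumes "continuous_map Z euclideanreal \<tau>"
    and "continuous_map (subtopology Z {z. \<tau> z \<le> c}) W f"
    and "continuous_map (subtopology Z {z. c \<le> \<tau> z}) W g"
    and "\<And>z. z \<in> topspace Z \<Longrightarrow> \<tau> z = c \<Longrightarrow> f z = g z"
  shows "continuous_map Z W (\<lambda>z. if \<tau> z \<le> c then f z else g z)"
proof (rule continuous_map_cases_le)
  have "{z \<in> topspace Z. \<tau> z \<le> c} \<subseteq> {z. \<tau> z \<le> c}" "{z \<in> topspace Z. c \<le> \<tau> z} \<subseteq> {z. c \<le> \<tau> z}"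
    by auto
  then show "continuous_map (subtopology Z {z \<in> topspace Z. \<tau> z \<le> c}) W f"
    and "continuous_map (subtopology Z {z \<in> topspace Z. c \<le> \<tau> z}) W g"
    using assms(2,3) continuous_map_from_subtopology_mono by blast+
qed (use assms in auto)

section \<open>Fibre homotopies and fibre homotopy equivalences\<close>

lemma fibre_homotopic_iff:
  "fibre_homotopic E p E' p' k k' \<longleftrightarrow>
    (\<exists>h. continuous_map (prod_topology (top_of_set {0..1::real}) E) E' h \<and>
       (\<forall>e\<in>topspace E. h (0, e) = k e \<and> h (1, e) = k' e) \<and>
       (\<forall>r\<in>{0..1}. \<forall>e\<in>topspace E. p' (h (r, e)) = p e))"
  unfolding fibre_homotopic_def by (subst homotopic_with) auto

lemma fibre_mapD:
  assumes "fibre_map E p E' p' k" and "e \<in> topspace E"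
  shows "k e \<in> topspace E'" and "p' (k e) = p e"
  using assms continuous_map_image_subset_topspace unfolding fibre_map_def by fast+

lemma fibre_map_comp:
  assumes "fibre_map E p E' p' k" and "fibre_map E' p' E'' p'' m"
  shows "fibre_map E p E'' p'' (m \<circ> k)"
proof -
  have "p'' (m (k e)) = p e" if "e \<in> topspace E" for e
    using fibre_mapD[OF assms(1) that] fibre_mapD(2)[OF assms(2)] by simp
  then show ?thesis
    using assms unfolding fibre_map_def by (auto intro: continuous_map_compose)
qed

lemma fibre_homotopic_imp_fibre_map:
  assumes "fibre_homotopic E p E' p' k k'"
  shows "fibre_map E p E' p' k" and "fibre_map E p E' p' k'"
  using homotopic_with_imp_continuous_maps[OF assms[unfolded fibre_homotopic_def]]
    homotopic_with_imp_property[OF assms[unfolded fibre_homotopic_def]]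
  by (auto simp: fibre_map_def)

lemma fibre_homotopic_equal:
  assumes "fibre_map E p E' p' k" and "\<And>e. e \<in> topspace E \<Longrightarrow> k e = k' e"
  shows "fibre_homotopic E p E' p' k k'"
  using assms unfolding fibre_homotopic_def fibre_map_def by (intro homotopic_with_equal) auto

lemma fibre_homotopic_sym:
  "fibre_homotopic E p E' p' k k' \<Longrightarrow> fibre_homotopic E p E' p' k' k"
  unfolding fibre_homotopic_def by (simp add: homotopic_with_sym)

lemma fibre_homotopic_trans [trans]:
  "fibre_homotopic E p E' p' k k' \<Longrightarrow> fibre_homotopic E p E' p' k' k'' \<Longrightarrow>
     fibre_homotopic E p E' p' k k''"
  unfolding fibre_homotopic_def by (rule homotopic_with_trans)

lemma fibre_homotopic_comp_left:
  assumes "fibre_homotopic E p E' p' k k'" and "fibre_map E' p' E'' p'' m"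
  shows "fibre_homotopic E p E'' p'' (m \<circ> k) (m \<circ> k')"
proof -
  obtain h where h: "continuous_map (prod_topology (top_of_set {0..1::real}) E) E' h"
       "\<forall>e\<in>topspace E. h (0, e) = k e \<and> h (1, e) = k' e"
       "\<forall>r\<in>{0..1}. \<forall>e\<in>topspace E. p' (h (r, e)) = p e"
    using assms(1) unfolding fibre_homotopic_iff by blast
  have "h (r, e) \<in> topspace E'" if "r \<in> {0..1}" "e \<in> topspace E" for r e
    using continuous_map_image_subset_topspace[OF h(1)] that by (auto simp: image_subset_iff)
  with h assms(2) show ?thesis
    unfolding fibre_homotopic_iff fibre_map_def
    by (intro exI[of _ "m \<circ> h"]) (auto intro: continuous_map_compose)
qed

lemma fibre_homotopic_comp_right:
  assumes "fibre_homotopic E' p' E'' p'' k k'" and "fibre_map E p E' p' m"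
  shows "fibre_homotopic E p E'' p'' (k \<circ> m) (k' \<circ> m)"
proof -
  obtain h where h: "continuous_map (prod_topology (top_of_set {0..1::real}) E') E'' h"
       "\<forall>e\<in>topspace E'. h (0, e) = k e \<and> h (1, e) = k' e"
       "\<forall>r\<in>{0..1}. \<forall>e\<in>topspace E'. p'' (h (r, e)) = p' e"
    using assms(1) unfolding fibre_homotopic_iff by blast
  have m: "continuous_map E E' m" "\<And>e. e \<in> topspace E \<Longrightarrow> m e \<in> topspace E' \<and> p' (m e) = p e"
    using assms(2) continuous_map_image_subset_topspace unfolding fibre_map_def by fast+
  have "continuous_map (prod_topology (top_of_set {0..1}) E) E'' (\<lambda>z. h (fst z, m (snd z)))"
    by (intro continuous_map_comp[OF _ h(1)] continuous_map_pairedI continuous_map_fst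
        continuous_map_comp[OF continuous_map_snd m(1)])
  with h(2,3) m(2) show ?thesis
    unfolding fibre_homotopic_iff
    by (intro exI[of _ "\<lambda>z. h (fst z, m (snd z))"]) simp
qed

lemma fibre_homotopy_equivalenceI:
  assumes "fibre_map E p E' p' f" and "fibre_map E' p' E p g"
    and "fibre_homotopic E p E p (g \<circ> f) id" and "fibre_homotopic E' p' E' p' (f \<circ> g) id"
  shows "fibre_homotopy_equivalence E p E' p' f"
  using assms unfolding fibre_homotopy_equivalence_def by blast

lemma fibre_homotopy_equivalenceE:
  assumes "fibre_homotopy_equivalence E p E' p' f"
  obtains g where "fibre_map E p E' p' f" and "fibre_map E' p' E p g"
    and "fibre_homotopic E p E p (g \<circ> f) id" and "fibre_homotopic E' p' E' p' (f \<circ> g) id"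
  using assms unfolding fibre_homotopy_equivalence_def by blast

text \<open>A left and a right inverse up to fibre homotopy are fibre homotopic to each other, as in any category.
So an inverse on the two sides may be built by two unrelated constructions, without any
compatibility between the homotopies.\<close>

lemma fibre_homotopy_equivalence_if_one_sided_inverses:
  assumes f: "fibre_map E p E' p' f"
    and l: "fibre_map E' p' E p l" "fibre_homotopic E p E p (l \<circ> f) id"
    and r: "fibre_map E' p' E p r" "fibre_homotopic E' p' E' p' (f \<circ> r) id"
  shows "fibre_homotopy_equivalence E p E' p' f"
proof -
  have "fibre_homotopic E' p' E p l r"
    using fibre_homotopic_trans[OF fibre_homotopic_sym[OF fibre_homotopic_comp_left[OF r(2) l(1)]]
        fibre_homotopic_comp_right[OF l(2) r(1), unfolded comp_assoc]]
    by simp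
  then have "fibre_homotopic E' p' E' p' (f \<circ> l) id"
    using fibre_homotopic_trans[OF fibre_homotopic_comp_left[OF _ f] r(2)] by blast
  then show ?thesis
    by (rule fibre_homotopy_equivalenceI[OF f l])
qed

lemma fibre_homotopy_equivalence_comp:
  assumes "fibre_homotopy_equivalence E p E' p' u" and "fibre_homotopy_equivalence E' p' E'' p'' v"
  shows "fibre_homotopy_equivalence E p E'' p'' (v \<circ> u)"
proof -
  obtain u' where u: "fibre_map E p E' p' u" "fibre_map E' p' E p u'"
      "fibre_homotopic E p E p (u' \<circ> u) id" "fibre_homotopic E' p' E' p' (u \<circ> u') id"
    using fibre_homotopy_equivalenceE[OF assms(1)] by blast
  obtain v' where v: "fibre_map E' p' E'' p'' v" "fibre_map E'' p'' E' p' v'"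
      "fibre_homotopic E' p' E' p' (v' \<circ> v) id" "fibre_homotopic E'' p'' E'' p'' (v \<circ> v') id"
    using fibre_homotopy_equivalenceE[OF assms(2)] by blast
  have "fibre_homotopic E p E p (u' \<circ> v' \<circ> (v \<circ> u)) id"
    using fibre_homotopic_trans[OF fibre_homotopic_comp_left[OF fibre_homotopic_comp_right[OF v(3) u(1)] u(2)]]
      u(3) by (simp add: comp_assoc)
  moreover have "fibre_homotopic E'' p'' E'' p'' (v \<circ> u \<circ> (u' \<circ> v')) id"
    using fibre_homotopic_trans[OF fibre_homotopic_comp_left[OF fibre_homotopic_comp_right[OF u(4) v(2)] v(1)]]
      v(4) by (simp add: comp_assoc)
  ultimately show ?thesis
    by (rule fibre_homotopy_equivalenceI[OF fibre_map_comp[OF u(1) v(1)] fibre_map_comp[OF v(2) u(2)]])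
qed

text \<open>The half of the two-out-of-three property which passes from \<open>h\<close> and \<open>h \<circ> g\<close> to \<open>g\<close>: if \<open>w\<close> is
inverse to \<open>v \<circ> u\<close>, then \<open>w \<circ> v\<close> is inverse to \<open>u\<close>; on the right this uses that an inverse of \<open>v\<close>
allows \<open>v\<close> to be cancelled on the left.\<close>

lemma fibre_homotopy_equivalence_cancel_left:
  assumes u: "fibre_map E p E' p' u" and vu: "fibre_homotopy_equivalence E p E'' p'' (v \<circ> u)"
    and v: "fibre_homotopy_equivalence E' p' E'' p'' v"
  shows "fibre_homotopy_equivalence E p E' p' u"
proof -
  obtain v' where v: "fibre_map E' p' E'' p'' v" "fibre_map E'' p'' E' p' v'"
      "fibre_homotopic E' p' E' p' (v' \<circ> v) id" "fibre_homotopic E'' p'' E'' p'' (v \<circ> v') id"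
    using fibre_homotopy_equivalenceE[OF assms(3)] by blast
  obtain w where w: "fibre_map E'' p'' E p w"
      "fibre_homotopic E p E p (w \<circ> (v \<circ> u)) id" "fibre_homotopic E'' p'' E'' p'' (v \<circ> u \<circ> w) id"
    using fibre_homotopy_equivalenceE[OF assms(2)] by blast
  have "fibre_homotopic E' p' E' p' (u \<circ> (w \<circ> v)) (v' \<circ> (v \<circ> u \<circ> w) \<circ> v)"
    using fibre_homotopic_comp_right[OF fibre_homotopic_sym[OF v(3)]
        fibre_map_comp[OF fibre_map_comp[OF v(1) w(1)] u]]
    by (simp add: comp_assoc)
  also have "fibre_homotopic E' p' E' p' \<dots> (v' \<circ> v)"
    using fibre_homotopic_comp_right[OF fibre_homotopic_comp_left[OF w(3) v(2)] v(1)]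
    by (simp add: comp_assoc)
  also note v(3)
  finally show ?thesis
    using fibre_homotopy_equivalence_if_one_sided_inverses[OF u, of "w \<circ> v" "w \<circ> v"]
      fibre_map_comp[OF v(1) w(1)] w(2) by (simp add: comp_assoc)
qed

lemma fibre_homotopy_equivalence_homotopic:
  assumes "fibre_homotopy_equivalence E p E' p' f" and "fibre_homotopic E p E' p' f f'"
  shows "fibre_homotopy_equivalence E p E' p' f'"
proof -
  obtain g where g: "fibre_map E' p' E p g"
      "fibre_homotopic E p E p (g \<circ> f) id" "fibre_homotopic E' p' E' p' (f \<circ> g) id"
    using fibre_homotopy_equivalenceE[OF assms(1)] by blast
  note sy = fibre_homotopic_sym[OF assms(2)]
  show ?thesis
    by (rule fibre_homotopy_equivalenceI[OF fibre_homotopic_imp_fibre_map(2)[OF assms(2)] g(1)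
        fibre_homotopic_trans[OF fibre_homotopic_comp_left[OF sy g(1)] g(2)]
        fibre_homotopic_trans[OF fibre_homotopic_comp_right[OF sy g(1)] g(3)]])
qed

lemma fibre_homotopy_equivalence_cong:
  assumes "fibre_homotopy_equivalence E p E' p' f" and "\<And>e. e \<in> topspace E \<Longrightarrow> f e = f' e"
  shows "fibre_homotopy_equivalence E p E' p' f'"
  by (rule fibre_homotopy_equivalence_homotopic[OF assms(1) fibre_homotopic_equal])
     (use assms in \<open>auto simp: fibre_homotopy_equivalence_def\<close>)

text \<open>Restriction to a part of the base, which makes sense of statements that hold locally over the base.\<close>

definition over :: "'e topology \<Rightarrow> ('e \<Rightarrow> 'b) \<Rightarrow> 'b set \<Rightarrow> 'e topology" where
  "over E p S = subtopology E {e. p e \<in> S}"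

lemma topspace_over [simp]: "topspace (over E p S) = {e \<in> topspace E. p e \<in> S}"
  by (auto simp: over_def)

lemma fibre_map_over:
  assumes "fibre_map E p E' p' k"
  shows "fibre_map (over E p S) p (over E' p' S) p' k"
  using assms unfolding fibre_map_def over_def
  by (auto simp: continuous_map_in_subtopology continuous_map_from_subtopology)

lemma fibre_homotopic_over:
  assumes "fibre_homotopic (over E p S) p (over E' p' S) p' k k'" and "T \<subseteq> S"
  shows "fibre_homotopic (over E p T) p (over E' p' T) p' k k'"
proof -
  obtain h where h: "continuous_map (prod_topology (top_of_set {0..1::real}) (over E p S)) (over E' p' S) h"
       "\<forall>e\<in>topspace (over E p S). h (0, e) = k e \<and> h (1, e) = k' e"
       "\<forall>r\<in>{0..1}. \<forall>e\<in>topspace (over E p S). p' (h (r, e)) = p e"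
    using assms(1) unfolding fibre_homotopic_iff by blast
  have "over E p T = subtopology (over E p S) {e. p e \<in> T}"
    using assms(2) unfolding over_def subtopology_subtopology
    by (intro arg_cong[of _ _ "subtopology E"]) auto
  then have "continuous_map (over E p T) (over E p S) (\<lambda>e. e)"
    by (simp add: continuous_map_from_subtopology)
  then have "continuous_map (prod_topology (top_of_set {0..1}) (over E p T)) (over E' p' S)
      (\<lambda>z. h (fst z, snd z))"
    by (intro continuous_map_comp[OF _ h(1)] continuous_map_pairedI continuous_map_fst)
       (rule continuous_map_comp[OF continuous_map_snd])
  then have "continuous_map (prod_topology (top_of_set {0..1}) (over E p T)) (over E' p' S) h"
    by simp
  then have "continuous_map (prod_topology (top_of_set {0..1}) (over E p T)) (over E' p' T) h"
    using h(3) assms(2) unfolding over_def continuous_map_in_subtopology by auto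
  then show ?thesis
    using h assms(2) unfolding fibre_homotopic_iff by (intro exI[of _ h]) auto
qed

lemma fibre_homotopic_over_from:
  assumes "fibre_homotopic E p E' p' k k'"
  shows "fibre_homotopic (over E p S) p (over E' p' S) p' k k'"
proof -
  have "over E p UNIV = E" "over E' p' UNIV = E'" by (simp_all add: over_def)
  with fibre_homotopic_over[of E p UNIV E' p' k k' S] assms show ?thesis by simp
qed

section \<open>Gluing fibre homotopy equivalences\<close>

lemma continuous_map_into_over:
  assumes "continuous_map Z E m" and "\<And>z. z \<in> topspace Z \<Longrightarrow> p (m z) \<in> S"
  shows "continuous_map Z (over E p S) m"
  using assms unfolding over_def by (auto simp: continuous_map_in_subtopology)

text \<open>A homotopy \<open>h\<close> that is defined only over one side of a level set of \<open>\<tau>\<close> is run up to a parameter \<open>w\<close>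
that varies from point to point. The result continues by \<open>k\<close> on the other side as soon as the two agree
over the level set. In this way a homotopy over a part of the base acts on the whole space.\<close>

lemma continuous_map_cutoff_above:
  assumes \<tau>: "continuous_map E euclideanreal (\<lambda>e. \<tau> (p e))"
    and h: "continuous_map (prod_topology (top_of_set {0..1::real}) (over E p {b. \<tau> b \<le> c})) W h"
    and k: "continuous_map (over E p {b. c \<le> \<tau> b}) W k"
    and w: "continuous_map Z euclideanreal w" "\<And>z. z \<in> topspace Z \<Longrightarrow> 0 \<le> w z \<and> w z \<le> 1"
    and m: "continuous_map Z E m"
    and eq: "\<And>z. z \<in> topspace Z \<Longrightarrow> \<tau> (p (m z)) = c \<Longrightarrow> h (w z, m z) = k (m z)"
  shows "continuous_map Z W (\<lambda>z. if \<tau> (p (m z)) \<le> c then h (w z, m z) else k (m z))"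
proof (rule continuous_map_glue_le)
  show "continuous_map Z euclideanreal (\<lambda>z. \<tau> (p (m z)))"
    by (rule continuous_map_comp[OF m \<tau>])
  show "continuous_map (subtopology Z {z. \<tau> (p (m z)) \<le> c}) W (\<lambda>z. h (w z, m z))"
    by (rule continuous_map_homotopy_at[OF h])
       (use w m in \<open>auto intro!: continuous_map_into_over intro: continuous_map_from_subtopology\<close>)
  show "continuous_map (subtopology Z {z. c \<le> \<tau> (p (m z))}) W (\<lambda>z. k (m z))"
    by (rule continuous_map_comp[OF _ k])
       (use m in \<open>auto intro!: continuous_map_into_over intro: continuous_map_from_subtopology\<close>)
qed (use eq in auto)

lemma continuous_map_cutoff_below:
  assumes \<tau>: "continuous_map E euclideanreal (\<lambda>e. \<tau> (p e))"
    and h: "continuous_map (prod_topology (top_of_set {0..1::real}) (over E p {b. c \<le> \<tau> b})) W h"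
    and k: "continuous_map (over E p {b. \<tau> b \<le> c}) W k"
    and w: "continuous_map Z euclideanreal w" "\<And>z. z \<in> topspace Z \<Longrightarrow> 0 \<le> w z \<and> w z \<le> 1"
    and m: "continuous_map Z E m"
    and eq: "\<And>z. z \<in> topspace Z \<Longrightarrow> \<tau> (p (m z)) = c \<Longrightarrow> h (w z, m z) = k (m z)"
  shows "continuous_map Z W (\<lambda>z. if \<tau> (p (m z)) \<le> c then k (m z) else h (w z, m z))"
proof (rule continuous_map_glue_le)
  show "continuous_map Z euclideanreal (\<lambda>z. \<tau> (p (m z)))"
    by (rule continuous_map_comp[OF m \<tau>])
  show "continuous_map (subtopology Z {z. c \<le> \<tau> (p (m z))}) W (\<lambda>z. h (w z, m z))"
    by (rule continuous_map_homotopy_at[OF h])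
       (use w m in \<open>auto intro!: continuous_map_into_over intro: continuous_map_from_subtopology\<close>)
  show "continuous_map (subtopology Z {z. \<tau> (p (m z)) \<le> c}) W (\<lambda>z. k (m z))"
    by (rule continuous_map_comp[OF _ k])
       (use m in \<open>auto intro!: continuous_map_into_over intro: continuous_map_from_subtopology\<close>)
qed (use eq in auto)

lemma continuous_map_from_over: "continuous_map E W k \<Longrightarrow> continuous_map (over E p S) W k"
  unfolding over_def by (rule continuous_map_from_subtopology)

text \<open>The retraction of the real line onto the unit interval, which serves as a cutoff function.\<close>

definition clamp01 :: "real \<Rightarrow> real" where
  "clamp01 x = max 0 (min 1 x)"

lemma clamp01_simps [simp]:
  "0 \<le> clamp01 x" "clamp01 x \<le> 1" "x \<le> 0 \<Longrightarrow> clamp01 x = 0" "1 \<le> x \<Longrightarrow> clamp01 x = 1"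
  by (auto simp: clamp01_def)

lemma continuous_map_clamp01 [continuous_intros]:
  "continuous_map Z euclideanreal w \<Longrightarrow> continuous_map Z euclideanreal (\<lambda>z. clamp01 (w z))"
  unfolding clamp01_def by (intro continuous_intros) auto

lemma fibre_homotopicI:
  assumes "continuous_map (prod_topology (top_of_set {0..1::real}) E) E' (\<lambda>z. h (fst z) (snd z))"
    and "\<And>e. e \<in> topspace E \<Longrightarrow> h 0 e = k e" and "\<And>e. e \<in> topspace E \<Longrightarrow> h 1 e = k' e"
    and "\<And>r e. 0 \<le> r \<Longrightarrow> r \<le> 1 \<Longrightarrow> e \<in> topspace E \<Longrightarrow> p' (h r e) = p e"
  shows "fibre_homotopic E p E' p' k k'"
  unfolding fibre_homotopic_iff using assms by (intro exI[of _ "\<lambda>z. h (fst z) (snd z)"]) auto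

lemma fibre_homotopicE:
  assumes "fibre_homotopic E p E' p' k k'"
  obtains h where "continuous_map (prod_topology (top_of_set {0..1::real}) E) E' h"
    and "\<And>e. e \<in> topspace E \<Longrightarrow> h (0, e) = k e" and "\<And>e. e \<in> topspace E \<Longrightarrow> h (1, e) = k' e"
    and "\<And>r e. 0 \<le> r \<Longrightarrow> r \<le> 1 \<Longrightarrow> e \<in> topspace E \<Longrightarrow> h (r, e) \<in> topspace E' \<and> p' (h (r, e)) = p e"
proof -
  obtain h where h: "continuous_map (prod_topology (top_of_set {0..1::real}) E) E' h"
       "\<forall>e\<in>topspace E. h (0, e) = k e \<and> h (1, e) = k' e"
       "\<forall>r\<in>{0..1}. \<forall>e\<in>topspace E. p' (h (r, e)) = p e"
    using assms unfolding fibre_homotopic_iff by blast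
  have "h (r, e) \<in> topspace E'" if "0 \<le> r" "r \<le> 1" "e \<in> topspace E" for r e
    using continuous_map_image_subset_topspace[OF h(1)] that by (auto simp: image_subset_iff)
  with h show ?thesis by (intro that[of h]) auto
qed

text \<open>A fibre self-map \<open>u\<close> which is homotopic to the identity over each of two overlapping parts of the base
need not be globally homotopic to the identity: over the overlap the two homotopies differ by a loop
\<open>D\<close> of self-maps based at the identity, and \<open>u\<close> is homotopic to the map that runs through \<open>D\<close> as
\<open>\<tau>\<close> increases across the overlap. Such a map has the inverse which runs through \<open>D\<close> backwards.
To avoid composing two nontrivial members of the loop, the loop is traversed while \<open>1 \<le> \<tau> \<le> 2\<close>
and the reversed loop while \<open>2 \<le> \<tau> \<le> 3\<close>. In either order the composite is then the path that
goes along \<open>D\<close> and back, which can be pulled back to the identity.\<close>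

lemma locally_identity_imp_fibre_homotopy_equivalence:
  fixes \<tau> :: "'b \<Rightarrow> real"
  assumes \<tau>: "continuous_map E euclideanreal (\<lambda>e. \<tau> (p e))"
    and u: "fibre_map E p E p u"
    and lo: "fibre_homotopic (over E p {b. \<tau> b \<le> 3}) p (over E p {b. \<tau> b \<le> 3}) p u id"
    and hi: "fibre_homotopic (over E p {b. 0 \<le> \<tau> b}) p (over E p {b. 0 \<le> \<tau> b}) p u id"
  shows "fibre_homotopy_equivalence E p E p u"
proof -
  let ?I = "top_of_set {0..1::real}"
  have intoE: "continuous_map Z (over E p S) h \<Longrightarrow> continuous_map Z E h" for Z h S
    unfolding over_def by (rule continuous_map_into_fulltopology)
  have sndE: "continuous_map (prod_topology ?I E) E snd" by (rule continuous_map_snd)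
  have fst_real: "continuous_map (prod_topology ?I E) euclideanreal fst"
    using continuous_map_fst continuous_map_into_fulltopology by blast
  note \<tau>_snd = continuous_map_comp[OF sndE \<tau>]
  have uc: "continuous_map E E u" and up: "\<And>e. e \<in> topspace E \<Longrightarrow> u e \<in> topspace E \<and> p (u e) = p e"
    using u fibre_mapD[OF u] by (auto simp: fibre_map_def)
  obtain C where C: "continuous_map (prod_topology ?I (over E p {b. 0 \<le> \<tau> b})) (over E p {b. 0 \<le> \<tau> b}) C"
      "\<And>e. e \<in> topspace (over E p {b. 0 \<le> \<tau> b}) \<Longrightarrow> C (0, e) = u e"
      "\<And>e. e \<in> topspace (over E p {b. 0 \<le> \<tau> b}) \<Longrightarrow> C (1, e) = id e"
      "\<And>r e. 0 \<le> r \<Longrightarrow> r \<le> 1 \<Longrightarrow> e \<in> topspace (over E p {b. 0 \<le> \<tau> b})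
         \<Longrightarrow> C (r, e) \<in> topspace (over E p {b. 0 \<le> \<tau> b}) \<and> p (C (r, e)) = p e"
    using fibre_homotopicE[OF hi] by blast
  \<comment> \<open>First \<open>u\<close> is deformed to a map \<open>u1\<close> that is the identity for \<open>\<tau> \<ge> 1\<close>. The homotopy \<open>D\<close> from the
    identity to \<open>u1\<close> over \<open>\<tau> \<le> 3\<close> is therefore a loop where \<open>1 \<le> \<tau>\<close>.\<close>
  define U where "U r e = (if \<tau> (p e) \<le> 0 then u e else C (r * clamp01 (\<tau> (p e)), e))" for r e
  define u1 where "u1 = U 1"
  have "fibre_homotopic E p E p u u1"
  proof (rule fibre_homotopicI[where h = U])
    show "continuous_map (prod_topology ?I E) E (\<lambda>z. U (fst z) (snd z))"
      unfolding U_def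
      by (rule continuous_map_cutoff_below[OF \<tau> intoE[OF C(1)] continuous_map_from_over[OF uc] _ _ sndE])
         (auto intro!: continuous_intros fst_real \<tau>_snd mult_le_one simp: C(2))
  qed (auto simp: U_def u1_def C up mult_le_one)
  note u_u1 = this
  have u1_id: "u1 e = e" if "e \<in> topspace E" "1 \<le> \<tau> (p e)" for e
    using that by (simp add: u1_def U_def C(3))
  have u1: "fibre_map E p E p u1"
    by (rule fibre_homotopic_imp_fibre_map[OF u_u1])
  have "fibre_homotopic (over E p {b. \<tau> b \<le> 3}) p (over E p {b. \<tau> b \<le> 3}) p id u1"
    using fibre_homotopic_trans[OF fibre_homotopic_sym[OF lo] fibre_homotopic_over_from[OF u_u1]] .
  then obtain D where D: "continuous_map (prod_topology ?I (over E p {b. \<tau> b \<le> 3})) (over E p {b. \<tau> b \<le> 3}) D"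
      "\<And>e. e \<in> topspace (over E p {b. \<tau> b \<le> 3}) \<Longrightarrow> D (0, e) = id e"
      "\<And>e. e \<in> topspace (over E p {b. \<tau> b \<le> 3}) \<Longrightarrow> D (1, e) = u1 e"
      "\<And>r e. 0 \<le> r \<Longrightarrow> r \<le> 1 \<Longrightarrow> e \<in> topspace (over E p {b. \<tau> b \<le> 3})
         \<Longrightarrow> D (r, e) \<in> topspace (over E p {b. \<tau> b \<le> 3}) \<and> p (D (r, e)) = p e"
    by (rule fibre_homotopicE) blast
  \<comment> \<open>Past \<open>\<tau> = 3\<close> the homotopy \<open>D\<close> is not available. There the identity replaces it, so its parameter has to
    have reached \<open>0\<close> or \<open>1\<close> when \<open>\<tau> = 3\<close>.\<close>
  define Q where "Q s e = (if \<tau> (p e) \<le> 3 then D (s, e) else e)" for s e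
  have Q_cont: "continuous_map Z E (\<lambda>z. Q (w z) (m z))"
    if "continuous_map Z euclideanreal w" "\<And>z. z \<in> topspace Z \<Longrightarrow> 0 \<le> w z \<and> w z \<le> 1"
      "continuous_map Z E m" "\<And>z. z \<in> topspace Z \<Longrightarrow> \<tau> (p (m z)) = 3 \<Longrightarrow> w z = 0 \<or> w z = 1" for Z w m
    unfolding Q_def
  proof (rule continuous_map_cutoff_above[OF \<tau> intoE[OF D(1)] _ that(1-3)])
    fix z assume z: "z \<in> topspace Z" "\<tau> (p (m z)) = 3"
    then have "m z \<in> topspace E" using that(3) continuous_map_image_subset_topspace by blast
    with z that(4) show "D (w z, m z) = m z"
      using D(2,3)[of "m z"] u1_id[of "m z"] by fastforce
  qed (simp_all add: continuous_map_from_over)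
  have Q_over: "Q s e \<in> topspace E \<and> p (Q s e) = p e" if "0 \<le> s" "s \<le> 1" "e \<in> topspace E" for s e
    using that D(4)[of s e] by (auto simp: Q_def)
  have Q0: "Q 0 e = e" and Q1: "Q 1 e = u1 e" if "e \<in> topspace E" for e
    using that D(2,3)[of e] u1_id[of e] by (auto simp: Q_def)
  define u2 where "u2 e = Q (clamp01 (\<tau> (p e) - 1)) e" for e
  define v where "v e = (if \<tau> (p e) \<le> 2 then e else Q (clamp01 (3 - \<tau> (p e))) e)" for e
  have "fibre_homotopic E p E p u2 u1"
    by (rule fibre_homotopicI[where h = "\<lambda>r e. Q (max r (clamp01 (\<tau> (p e) - 1))) e"])
       (auto intro!: Q_cont continuous_intros fst_real \<tau>_snd sndE simp: u2_def Q1 Q_over max_absorb1 max_absorb2 le_max_iff_disj)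
  then have u_u2: "fibre_homotopic E p E p u2 u"
    using fibre_homotopic_trans fibre_homotopic_sym u_u1 by metis
  have v_cont: "continuous_map E E v"
    unfolding v_def
  proof (rule continuous_map_glue_le[OF \<tau>])
    have "continuous_map E E (\<lambda>e. Q (clamp01 (3 - \<tau> (p e))) e)"
      by (rule Q_cont) (auto intro!: continuous_intros \<tau>)
    then show "continuous_map (subtopology E {e. 2 \<le> \<tau> (p e)}) E (\<lambda>e. Q (clamp01 (3 - \<tau> (p e))) e)"
      by (rule continuous_map_from_subtopology)
  qed (auto simp: Q1 u1_id)
  have v_over: "v e \<in> topspace E \<and> p (v e) = p e" if "e \<in> topspace E" for e
    using that Q_over by (auto simp: v_def)
  have v: "fibre_map E p E p v"
    using v_cont v_over by (auto simp: fibre_map_def)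
  \<comment> \<open>The parameter is a tent function of \<open>\<tau>\<close> with support \<open>1 \<le> \<tau> \<le> 3\<close> and peak at \<open>\<tau> = 2\<close>; shrinking it to
    zero deforms \<open>K\<close> to the identity.\<close>
  define K where "K e = Q (min (clamp01 (\<tau> (p e) - 1)) (clamp01 (3 - \<tau> (p e)))) e" for e
  have K: "fibre_homotopic E p E p K id"
    by (rule fibre_homotopic_sym, rule fibre_homotopicI[where
          h = "\<lambda>r e. Q (r * min (clamp01 (\<tau> (p e) - 1)) (clamp01 (3 - \<tau> (p e)))) e"])
       (auto intro!: Q_cont continuous_intros fst_real \<tau>_snd sndE mult_le_one
          simp: K_def Q0 Q_over mult_le_one min_le_iff_disj)
  have u2v: "u2 (v e) = K e" and vu2: "v (u2 e) = K e" if e: "e \<in> topspace E" for e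
  proof -
    have pv: "p (v e) = p e" "v e \<in> topspace E" using v_over[OF e] by auto
    have pu: "p (u2 e) = p e" unfolding u2_def using Q_over[OF _ _ e] by simp
    have "u2 (v e) = K e \<and> v (u2 e) = K e"
    proof (cases "\<tau> (p e) \<le> 2")
      case True
      then show ?thesis
        unfolding K_def v_def[of "u2 e"] pu by (simp add: v_def u2_def min_def)
    next
      case False
      then have "u2 e = e" unfolding u2_def using e by (simp add: Q1 u1_id)
      moreover have "u2 (v e) = v e"
        unfolding u2_def pv(1) using False pv by (simp add: Q1 u1_id)
      ultimately show ?thesis using False by (simp add: K_def v_def min_absorb2)
    qed
    then show "u2 (v e) = K e" "v (u2 e) = K e" by auto
  qed
  have "fibre_homotopic E p E p (v \<circ> u2) id" "fibre_homotopic E p E p (u2 \<circ> v) id"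
    using fibre_homotopic_imp_fibre_map(1)[OF u_u2] v u2v vu2
    by (auto intro!: fibre_homotopic_trans[OF fibre_homotopic_equal K] fibre_map_comp)
  then have "fibre_homotopy_equivalence E p E p u2"
    by (intro fibre_homotopy_equivalenceI[OF fibre_homotopic_imp_fibre_map(1)[OF u_u2] v])
  then show ?thesis
    using fibre_homotopy_equivalence_homotopic u_u2 by blast
qed


lemma over_over: "over (over E p S) p T = over E p (S \<inter> T)"
  unfolding over_def subtopology_subtopology by (intro arg_cong[of _ _ "subtopology E"]) auto

lemma fibre_homotopic_over_target:
  "fibre_homotopic (over E p S) p (over E' p' S) p' k k' \<longleftrightarrow> fibre_homotopic (over E p S) p E' p' k k'"
  (is "?L \<longleftrightarrow> ?R")
proof
  assume ?L
  then show ?R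
    unfolding fibre_homotopic_iff over_def by (meson continuous_map_into_fulltopology)
next
  assume ?R
  then obtain h where h: "continuous_map (prod_topology (top_of_set {0..1::real}) (over E p S)) E' h"
       "\<forall>e\<in>topspace (over E p S). h (0, e) = k e \<and> h (1, e) = k' e"
       "\<forall>r\<in>{0..1}. \<forall>e\<in>topspace (over E p S). p' (h (r, e)) = p e"
    unfolding fibre_homotopic_iff by blast
  moreover from h have "continuous_map (prod_topology (top_of_set {0..1::real}) (over E p S)) (over E' p' S) h"
    by (intro continuous_map_into_over) auto
  ultimately show ?L
    unfolding fibre_homotopic_iff by blast
qed

lemma continuous_map_into_fulltopology_over:
  "continuous_map Z (over E p S) h \<Longrightarrow> continuous_map Z E h"
  unfolding over_def by (rule continuous_map_into_fulltopology)

text \<open>The map \<open>k\<close> is \<open>k1\<close> for \<open>\<tau> \<le> 1\<close> and \<open>k2\<close> for \<open>\<tau> \<ge> 2\<close>; in between it runs through the homotopy from \<open>k1\<close> to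
\<open>k2\<close>. Both claimed homotopies come from shifting the interval on which this change takes place.\<close>

lemma blend_fibre_maps:
  fixes \<tau> :: "'b \<Rightarrow> real"
  defines "lo \<equiv> {b. \<tau> b \<le> 3}" and "hi \<equiv> {b. 0 \<le> \<tau> b}"
  assumes \<tau>: "continuous_map E euclideanreal (\<lambda>e. \<tau> (p e))"
    and k1: "fibre_map (over E p lo) p E' p' k1" and k2: "fibre_map (over E p hi) p E' p' k2"
    and hom: "fibre_homotopic (over E p (lo \<inter> hi)) p E' p' k1 k2"
  obtains k where "fibre_map E p E' p' k"
    and "fibre_homotopic (over E p lo) p E' p' k k1" and "fibre_homotopic (over E p hi) p E' p' k k2"
proof -
  let ?I = "top_of_set {0..1::real}"
  obtain h where h: "continuous_map (prod_topology ?I (over E p (lo \<inter> hi))) E' h"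
      "\<And>e. e \<in> topspace (over E p (lo \<inter> hi)) \<Longrightarrow> h (0, e) = k1 e"
      "\<And>e. e \<in> topspace (over E p (lo \<inter> hi)) \<Longrightarrow> h (1, e) = k2 e"
      "\<And>r e. 0 \<le> r \<Longrightarrow> r \<le> 1 \<Longrightarrow> e \<in> topspace (over E p (lo \<inter> hi))
         \<Longrightarrow> h (r, e) \<in> topspace E' \<and> p' (h (r, e)) = p e"
    using fibre_homotopicE[OF hom] by blast
  have snd_over: "continuous_map (prod_topology ?I (over E p S)) (over E p S) snd" for S
    by (rule continuous_map_snd)
  have fst_real: "continuous_map (prod_topology ?I (over E p S)) euclideanreal fst" for S
    using continuous_map_fst continuous_map_into_fulltopology by blast
  have \<tau>_over: "continuous_map (over E p S) euclideanreal (\<lambda>e. \<tau> (p e))" for S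
    by (rule continuous_map_from_over[OF \<tau>])
  note \<tau>_snd = continuous_map_comp[OF snd_over \<tau>_over]
  have k1c: "continuous_map (over E p lo) E' k1" and k2c: "continuous_map (over E p hi) E' k2"
    using k1 k2 by (auto simp: fibre_map_def)
  have k1p: "p' (k1 e) = p e" if "e \<in> topspace E" "\<tau> (p e) \<le> 3" for e
    using fibre_mapD(2)[OF k1] that by (simp add: lo_def)
  have k2p: "p' (k2 e) = p e" if "e \<in> topspace E" "0 \<le> \<tau> (p e)" for e
    using fibre_mapD(2)[OF k2] that by (simp add: hi_def)
  define c where "c e = clamp01 (\<tau> (p e) - 1)" for e
  define H1 where "H1 r e = (if \<tau> (p e) \<le> 0 then k1 e else h ((1 - r) * c e, e))" for r e
  define H2 where "H2 r e = (if \<tau> (p e) \<le> 3 then h (max r (c e), e) else k2 e)" for r e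
  have mid: "over (over E p lo) p {b. 0 \<le> \<tau> b} = over E p (lo \<inter> hi)"
       "over (over E p hi) p {b. \<tau> b \<le> 3} = over E p (lo \<inter> hi)"
    by (simp_all add: over_over lo_def hi_def Int_commute)
  have 1: "fibre_homotopic (over E p lo) p E' p' (H1 0) k1"
  proof (rule fibre_homotopicI[where h = H1])
    show "continuous_map (prod_topology ?I (over E p lo)) E' (\<lambda>z. H1 (fst z) (snd z))"
      unfolding H1_def
      by (rule continuous_map_cutoff_below[OF \<tau>_over h(1)[folded mid(1)] continuous_map_from_over[OF k1c] _ _ snd_over])
         (auto intro!: continuous_intros fst_real \<tau>_snd mult_le_one simp: h(2) lo_def hi_def c_def)
  qed (auto simp: H1_def h lo_def hi_def k1p c_def mult_le_one)
  have 2: "fibre_homotopic (over E p hi) p E' p' (H2 0) k2"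
  proof (rule fibre_homotopicI[where h = H2])
    show "continuous_map (prod_topology ?I (over E p hi)) E' (\<lambda>z. H2 (fst z) (snd z))"
      unfolding H2_def
      by (rule continuous_map_cutoff_above[OF \<tau>_over h(1)[folded mid(2)] continuous_map_from_over[OF k2c] _ _ snd_over])
         (auto intro!: continuous_intros fst_real \<tau>_snd
            simp: h(3) lo_def hi_def c_def max_absorb1 max_absorb2 le_max_iff_disj)
  qed (auto simp: H2_def h lo_def hi_def k2p c_def max_absorb1 le_max_iff_disj)
  define k where "k e = (if \<tau> (p e) \<le> 3/2 then H1 0 e else H2 0 e)" for e
  have k_lo: "k e = H1 0 e" if "e \<in> topspace (over E p lo)" for e
    using that by (auto simp: k_def H1_def H2_def lo_def c_def max_absorb2)
  have k_hi: "k e = H2 0 e" if "e \<in> topspace (over E p hi)" for e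
    using that by (auto simp: k_def H1_def H2_def lo_def hi_def c_def max_absorb2 h(2))
  have H_fm: "fibre_map (over E p lo) p E' p' (H1 0)" "fibre_map (over E p hi) p E' p' (H2 0)"
    using fibre_homotopic_imp_fibre_map 1 2 by blast+
  have "continuous_map E E' k"
    unfolding k_def
  proof (rule continuous_map_glue_le[OF \<tau>])
    have "continuous_map (subtopology E {e. p e \<in> lo}) E' (H1 0)"
      using H_fm(1) by (simp add: fibre_map_def over_def)
    then show "continuous_map (subtopology E {e. \<tau> (p e) \<le> 3/2}) E' (H1 0)"
      by (rule continuous_map_from_subtopology_mono) (auto simp: lo_def)
    have "continuous_map (subtopology E {e. p e \<in> hi}) E' (H2 0)"
      using H_fm(2) by (simp add: fibre_map_def over_def)
    then show "continuous_map (subtopology E {e. 3/2 \<le> \<tau> (p e)}) E' (H2 0)"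
      by (rule continuous_map_from_subtopology_mono) (auto simp: hi_def)
  qed (auto simp: H1_def H2_def lo_def hi_def c_def max_absorb2)
  moreover have "p' (k e) = p e" if "e \<in> topspace E" for e
    using that fibre_mapD(2)[OF H_fm(1)] fibre_mapD(2)[OF H_fm(2)] by (simp add: k_def lo_def hi_def)
  ultimately have k: "fibre_map E p E' p' k" by (simp add: fibre_map_def)
  show ?thesis
  proof (rule that[OF k])
    show "fibre_homotopic (over E p lo) p E' p' k k1"
      by (rule fibre_homotopic_trans[OF fibre_homotopic_sym[OF fibre_homotopic_equal[OF H_fm(1)]] 1])
         (simp add: k_lo)
    show "fibre_homotopic (over E p hi) p E' p' k k2"
      by (rule fibre_homotopic_trans[OF fibre_homotopic_sym[OF fibre_homotopic_equal[OF H_fm(2)]] 2])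
         (simp add: k_hi)
  qed
qed

text \<open>Inverses of \<open>f\<close> over the two parts are homotopic over the overlap, since inverses are unique up to homotopy,
and can be blended to a global map \<open>g\<close>. For an arbitrary choice of that homotopy, \<open>f \<circ> g\<close> and \<open>g \<circ> f\<close> need
not be homotopic to the identity. But they are so over each part, hence are equivalences, and this provides one-sided inverses of \<open>f\<close>. The overlap is normalised to \<open>0 \<le> \<tau> \<le> 3\<close>.\<close>

lemma fibre_homotopy_equivalence_glue_unit:
  fixes \<tau> :: "'b \<Rightarrow> real"
  defines "lo \<equiv> {b. \<tau> b \<le> 3}" and "hi \<equiv> {b. 0 \<le> \<tau> b}"
  assumes \<tau>: "continuous_map E euclideanreal (\<lambda>e. \<tau> (p e))"
    and \<tau>': "continuous_map E' euclideanreal (\<lambda>e. \<tau> (p' e))"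
    and f_lo: "fibre_homotopy_equivalence (over E p lo) p (over E' p' lo) p' f"
    and f_hi: "fibre_homotopy_equivalence (over E p hi) p (over E' p' hi) p' f"
  shows "fibre_homotopy_equivalence E p E' p' f"
proof -
  obtain g1 where g1: "fibre_map (over E p lo) p (over E' p' lo) p' f" "fibre_map (over E' p' lo) p' (over E p lo) p g1"
      "fibre_homotopic (over E p lo) p (over E p lo) p (g1 \<circ> f) id"
      "fibre_homotopic (over E' p' lo) p' (over E' p' lo) p' (f \<circ> g1) id"
    using fibre_homotopy_equivalenceE[OF f_lo] by blast
  obtain g2 where g2: "fibre_map (over E p hi) p (over E' p' hi) p' f" "fibre_map (over E' p' hi) p' (over E p hi) p g2"
      "fibre_homotopic (over E p hi) p (over E p hi) p (g2 \<circ> f) id"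
      "fibre_homotopic (over E' p' hi) p' (over E' p' hi) p' (f \<circ> g2) id"
    using fibre_homotopy_equivalenceE[OF f_hi] by blast
  have f: "fibre_map E p E' p' f"
  proof -
    have "continuous_map E E' (\<lambda>e. if \<tau> (p e) \<le> 1 then f e else f e)"
    proof (rule continuous_map_glue_le[OF \<tau>])
      have "continuous_map (over E p lo) E' f" "continuous_map (over E p hi) E' f"
        using g1(1) g2(1) continuous_map_into_fulltopology_over unfolding fibre_map_def by blast+
      then show "continuous_map (subtopology E {e. \<tau> (p e) \<le> 1}) E' f"
          "continuous_map (subtopology E {e. 1 \<le> \<tau> (p e)}) E' f"
        unfolding over_def lo_def hi_def
        by - (erule continuous_map_from_subtopology_mono, force)+
    qed auto
    moreover have "p' (f e) = p e" if "e \<in> topspace E" for e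
      using that fibre_mapD(2)[OF g1(1)] fibre_mapD(2)[OF g2(1)]
      by (cases "\<tau> (p e) \<le> 3") (auto simp: lo_def hi_def)
    ultimately show ?thesis by (simp add: fibre_map_def)
  qed
  let ?mid = "lo \<inter> hi"
  have "fibre_homotopic (over E' p' ?mid) p' (over E p ?mid) p g1 g2"
  proof -
    have m2: "fibre_map (over E' p' ?mid) p' (over E p ?mid) p g2"
      using fibre_map_over[OF g2(2), of lo] by (simp add: over_over Int_commute)
    have m1: "fibre_map (over E' p' ?mid) p' (over E p ?mid) p g1"
      using fibre_map_over[OF g1(2), of hi] by (simp add: over_over)
    have "fibre_homotopic (over E' p' ?mid) p' (over E p ?mid) p (g1 \<circ> (f \<circ> g2)) g1"
      using fibre_homotopic_comp_left[OF fibre_homotopic_over[OF g2(4)] m1] by simp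
    moreover have "fibre_homotopic (over E' p' ?mid) p' (over E p ?mid) p (g1 \<circ> f \<circ> g2) g2"
      using fibre_homotopic_comp_right[OF fibre_homotopic_over[OF g1(3)] m2] by simp
    ultimately show ?thesis
      using fibre_homotopic_trans fibre_homotopic_sym by (metis comp_assoc)
  qed
  then have hom: "fibre_homotopic (over E' p' ?mid) p' E p g1 g2"
    by (simp add: fibre_homotopic_over_target)
  have "fibre_map (over E' p' lo) p' E p g1" "fibre_map (over E' p' hi) p' E p g2"
    using g1(2) g2(2) continuous_map_into_fulltopology_over unfolding fibre_map_def by blast+
  then obtain g where g: "fibre_map E' p' E p g"
      "fibre_homotopic (over E' p' lo) p' E p g g1" "fibre_homotopic (over E' p' hi) p' E p g g2"
    by (rule blend_fibre_maps[where \<tau> = \<tau>, OF \<tau>', folded lo_def hi_def, OF _ _ hom])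
  note g_lo = fibre_homotopic_over_target[THEN iffD2, OF g(2)]
    and g_hi = fibre_homotopic_over_target[THEN iffD2, OF g(3)]
  have fg: "fibre_homotopy_equivalence E' p' E' p' (f \<circ> g)"
  proof (rule locally_identity_imp_fibre_homotopy_equivalence[where \<tau> = \<tau>])
    show "continuous_map E' euclideanreal (\<lambda>e. \<tau> (p' e))" by (rule \<tau>')
    show "fibre_map E' p' E' p' (f \<circ> g)" by (rule fibre_map_comp[OF g(1) f])
    have "fibre_homotopic (over E' p' lo) p' (over E' p' lo) p' (f \<circ> g) (f \<circ> g1)"
      by (rule fibre_homotopic_comp_left[OF g_lo g1(1)])
    from fibre_homotopic_trans[OF this g1(4)]
    show "fibre_homotopic (over E' p' {b. \<tau> b \<le> 3}) p' (over E' p' {b. \<tau> b \<le> 3}) p' (f \<circ> g) id"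
      by (simp only: lo_def)
    have "fibre_homotopic (over E' p' hi) p' (over E' p' hi) p' (f \<circ> g) (f \<circ> g2)"
      by (rule fibre_homotopic_comp_left[OF g_hi g2(1)])
    from fibre_homotopic_trans[OF this g2(4)]
    show "fibre_homotopic (over E' p' {b. 0 \<le> \<tau> b}) p' (over E' p' {b. 0 \<le> \<tau> b}) p' (f \<circ> g) id"
      by (simp only: hi_def)
  qed
  have gf: "fibre_homotopy_equivalence E p E p (g \<circ> f)"
  proof (rule locally_identity_imp_fibre_homotopy_equivalence[where \<tau> = \<tau>])
    show "continuous_map E euclideanreal (\<lambda>e. \<tau> (p e))" by (rule \<tau>)
    show "fibre_map E p E p (g \<circ> f)" by (rule fibre_map_comp[OF f g(1)])
    have "fibre_homotopic (over E p lo) p (over E p lo) p (g \<circ> f) (g1 \<circ> f)"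
      by (rule fibre_homotopic_comp_right[OF g_lo g1(1)])
    from fibre_homotopic_trans[OF this g1(3)]
    show "fibre_homotopic (over E p {b. \<tau> b \<le> 3}) p (over E p {b. \<tau> b \<le> 3}) p (g \<circ> f) id"
      by (simp only: lo_def)
    have "fibre_homotopic (over E p hi) p (over E p hi) p (g \<circ> f) (g2 \<circ> f)"
      by (rule fibre_homotopic_comp_right[OF g_hi g2(1)])
    from fibre_homotopic_trans[OF this g2(3)]
    show "fibre_homotopic (over E p {b. 0 \<le> \<tau> b}) p (over E p {b. 0 \<le> \<tau> b}) p (g \<circ> f) id"
      by (simp only: hi_def)
  qed
  obtain r where r: "fibre_map E' p' E' p' r" "fibre_homotopic E' p' E' p' (f \<circ> g \<circ> r) id"
    using fibre_homotopy_equivalenceE[OF fg] by blast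
  obtain l where l: "fibre_map E p E p l" "fibre_homotopic E p E p (l \<circ> (g \<circ> f)) id"
    using fibre_homotopy_equivalenceE[OF gf] by blast
  show ?thesis
    by (rule fibre_homotopy_equivalence_if_one_sided_inverses[OF f fibre_map_comp[OF g(1) l(1)] _
          fibre_map_comp[OF r(1) g(1)]])
       (use r(2) l(2) in \<open>simp_all add: comp_assoc\<close>)
qed

text \<open>A gluing theorem in the style of Dold for two overlapping closed parts of the base. The overlap has to
  have positive width: over two halves that only share a level set, there would be no room to pass from one
  local inverse to the other. No fibration hypothesis is made.\<close>

lemma fibre_homotopy_equivalence_glue:
  fixes \<tau> :: "'b \<Rightarrow> real"
  assumes ac: "a < c"
    and \<tau>: "continuous_map E euclideanreal (\<lambda>e. \<tau> (p e))" "continuous_map E' euclideanreal (\<lambda>e. \<tau> (p' e))"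
    and lo: "fibre_homotopy_equivalence (over E p {b. \<tau> b \<le> c}) p (over E' p' {b. \<tau> b \<le> c}) p' f"
    and hi: "fibre_homotopy_equivalence (over E p {b. a \<le> \<tau> b}) p (over E' p' {b. a \<le> \<tau> b}) p' f"
  shows "fibre_homotopy_equivalence E p E' p' f"
proof -
  define \<rho> where "\<rho> b = 3 * (\<tau> b - a) / (c - a)" for b
  have "{b. \<rho> b \<le> 3} = {b. \<tau> b \<le> c}" "{b. 0 \<le> \<rho> b} = {b. a \<le> \<tau> b}"
    using ac by (auto simp: \<rho>_def field_simps)
  moreover have "continuous_map E euclideanreal (\<lambda>e. \<rho> (p e))" "continuous_map E' euclideanreal (\<lambda>e. \<rho> (p' e))"
    unfolding \<rho>_def using ac by (auto intro!: continuous_intros \<tau>)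
  ultimately show ?thesis
    using fibre_homotopy_equivalence_glue_unit[where \<tau> = \<rho> and E = E and p = p and E' = E' and p' = p' and f = f]
      lo hi by simp
qed

section \<open>Weak homotopy equivalences\<close>

lemma path_components_map_component:
  assumes f: "continuous_map S T f" and x: "x \<in> topspace S"
  shows "path_components_map T f (path_component_of_set S x) = path_component_of_set T (f x)"
proof -
  have "path_component_of_set T (f y) = path_component_of_set T (f x)" if y: "path_component_of S x y" for y
  proof -
    obtain g where g: "pathin S g" "g 0 = x" "g 1 = y"
      using y unfolding path_component_of_def by blast
    have fxy: "path_component_of T (f x) (f y)"
      unfolding path_component_of_def
      by (rule exI[of _ "f \<circ> g"]) (use g f in \<open>auto simp: pathin_def intro: continuous_map_compose\<close>)
    then show ?thesis
      using path_component_of_trans[OF fxy] path_component_of_trans[OF path_component_of_sym[OF fxy]]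
      by blast
  qed
  moreover have "path_component_of S x x" using x by (simp add: path_component_of_refl)
  ultimately show ?thesis unfolding path_components_map_def by blast
qed

lemma cube_homotopic_class_eq:
  assumes "cube_homotopic n T a p q"
  shows "Collect (cube_homotopic n T a p) = Collect (cube_homotopic n T a q)"
  using homotopic_with_trans[OF assms[unfolded cube_homotopic_def]]
    homotopic_with_trans[OF homotopic_with_symD[OF assms[unfolded cube_homotopic_def]]]
  unfolding cube_homotopic_def by blast

lemma cube_homotopic_comp:
  assumes "cube_homotopic n S a p q" and "continuous_map S T f"
  shows "cube_homotopic n T (f a) (f \<circ> p) (f \<circ> q)"
  using assms unfolding cube_homotopic_def
  by (rule homotopic_with_compose_continuous_map_left) auto

text \<open>The induced map is given by a union over all representatives, and these all contribute the same class.
After this lemma one representative suffices.\<close>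

lemma homotopy_classes_map_class:
  assumes f: "continuous_map S T f"
    and p: "continuous_map (cube n) S p" "\<forall>x\<in>cube_boundary n. p x = a"
  shows "homotopy_classes_map n T (f a) f (Collect (cube_homotopic n S a p)) =
    Collect (cube_homotopic n T (f a) (f \<circ> p))"
proof -
  have "Collect (cube_homotopic n T (f a) (f \<circ> q)) = Collect (cube_homotopic n T (f a) (f \<circ> p))"
    if "cube_homotopic n S a p q" for q
    using cube_homotopic_class_eq[OF cube_homotopic_comp[OF that f]] by simp
  moreover have "cube_homotopic n S a p p"
    using p by (simp add: cube_homotopic_def)
  ultimately show ?thesis unfolding homotopy_classes_map_def by blast
qed

lemma homotopy_classesE:
  assumes "C \<in> homotopy_classes n S a"
  obtains p where "C = Collect (cube_homotopic n S a p)" and "continuous_map (cube n) S p"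
    and "\<forall>x\<in>cube_boundary n. p x = a"
  using assms unfolding homotopy_classes_def by auto

lemma homotopy_classes_map_in:
  assumes f: "continuous_map S T f" and C: "C \<in> homotopy_classes n S a"
  shows "homotopy_classes_map n T (f a) f C \<in> homotopy_classes n T (f a)"
proof -
  obtain p where p: "C = Collect (cube_homotopic n S a p)" "continuous_map (cube n) S p"
      "\<forall>x\<in>cube_boundary n. p x = a"
    using homotopy_classesE[OF C] by blast
  show ?thesis
    unfolding p(1) homotopy_classes_map_class[OF f p(2,3)] homotopy_classes_def
    by (intro CollectI exI[of _ "f \<circ> p"]) (use continuous_map_compose[OF p(2) f] p(3) in simp)
qed

lemma homotopy_classes_map_comp:
  assumes u: "continuous_map S T u" and v: "continuous_map T U v" and C: "C \<in> homotopy_classes n S a"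
  shows "homotopy_classes_map n U (v (u a)) v (homotopy_classes_map n T (u a) u C) =
    homotopy_classes_map n U (v (u a)) (v \<circ> u) C"
proof -
  obtain p where p: "C = Collect (cube_homotopic n S a p)" "continuous_map (cube n) S p"
      "\<forall>x\<in>cube_boundary n. p x = a"
    using homotopy_classesE[OF C] by blast
  have "homotopy_classes_map n U (v (u a)) v (homotopy_classes_map n T (u a) u C) =
      Collect (cube_homotopic n U (v (u a)) (v \<circ> (u \<circ> p)))"
    unfolding p(1) homotopy_classes_map_class[OF u p(2,3)]
    by (rule homotopy_classes_map_class[OF v continuous_map_compose[OF p(2) u]]) (simp add: p(3))
  then show ?thesis
    using homotopy_classes_map_class[OF continuous_map_compose[OF u v] p(2,3)]
    by (simp add: p(1) comp_assoc)
qed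

lemma homotopy_classes_map_cong:
  assumes f: "continuous_map S T f" and eq: "\<And>x. x \<in> topspace S \<Longrightarrow> f x = f' x"
    and a: "a \<in> topspace S" and C: "C \<in> homotopy_classes n S a"
  shows "homotopy_classes_map n T (f a) f C = homotopy_classes_map n T (f a) f' C"
proof -
  obtain p where p: "C = Collect (cube_homotopic n S a p)" "continuous_map (cube n) S p"
      "\<forall>x\<in>cube_boundary n. p x = a"
    using homotopy_classesE[OF C] by blast
  have fa: "f a = f' a" using eq a by blast
  have f': "continuous_map S T f'" using f eq continuous_map_eq by metis
  have ps: "p x \<in> topspace S" if "x \<in> topspace (cube n)" for x
    using continuous_map_image_subset_topspace[OF p(2)] that by blast
  have "cube_homotopic n T (f a) (f \<circ> p) (f' \<circ> p)"
    unfolding cube_homotopic_def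
    by (rule homotopic_with_equal)
       (use p eq fa ps f in \<open>auto intro: continuous_map_compose\<close>)
  then show ?thesis
    using cube_homotopic_class_eq homotopy_classes_map_class[OF f p(2,3)]
      homotopy_classes_map_class[OF f' p(2,3)] fa unfolding p(1) by metis
qed

lemma path_components_map_in:
  assumes "continuous_map S T f" and "C \<in> path_components_of S"
  shows "path_components_map T f C \<in> path_components_of T"
  using assms path_components_map_component[OF assms(1)] continuous_map_image_subset_topspace[OF assms(1)]
  unfolding path_components_of_def by auto

lemma path_components_map_comp:
  assumes u: "continuous_map S T u" and v: "continuous_map T U v" and C: "C \<in> path_components_of S"
  shows "path_components_map U v (path_components_map T u C) = path_components_map U (v \<circ> u) C"
proof -
  obtain x where x: "x \<in> topspace S" "C = path_component_of_set S x"
    using C unfolding path_components_of_def by blast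
  have "u x \<in> topspace T" using continuous_map_image_subset_topspace[OF u] x(1) by blast
  then show ?thesis
    using path_components_map_component[OF u x(1)] path_components_map_component[OF v]
      path_components_map_component[OF continuous_map_compose[OF u v] x(1)] by (simp add: x(2))
qed

lemma weak_homotopy_equivalence_cong:
  assumes f: "weak_homotopy_equivalence S T f" and eq: "\<And>x. x \<in> topspace S \<Longrightarrow> f x = f' x"
  shows "weak_homotopy_equivalence S T f'"
proof -
  have fc: "continuous_map S T f" using f by (simp add: weak_homotopy_equivalence_def)
  have f'c: "continuous_map S T f'" using fc eq continuous_map_eq by metis
  have "path_components_map T f C = path_components_map T f' C" if "C \<in> path_components_of S" for C
    using that path_components_map_component[OF fc] path_components_map_component[OF f'c] eq
    unfolding path_components_of_def by auto
  then have "bij_betw (path_components_map T f') (path_components_of S) (path_components_of T)"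
    using f bij_betw_cong unfolding weak_homotopy_equivalence_def by metis
  moreover have "bij_betw (homotopy_classes_map n T (f' a) f') (homotopy_classes n S a) (homotopy_classes n T (f' a))"
    if "1 \<le> n" "a \<in> topspace S" for n a
  proof -
    have "bij_betw (homotopy_classes_map n T (f a) f) (homotopy_classes n S a) (homotopy_classes n T (f a))"
      using f that unfolding weak_homotopy_equivalence_def by blast
    moreover have "bij_betw (homotopy_classes_map n T (f a) f) (homotopy_classes n S a) (homotopy_classes n T (f a)) \<longleftrightarrow>
        bij_betw (homotopy_classes_map n T (f a) f') (homotopy_classes n S a) (homotopy_classes n T (f a))"
      by (rule bij_betw_cong, rule homotopy_classes_map_cong[OF fc]) (use eq that(2) in auto)
    ultimately show ?thesis using eq[OF that(2)] by simp
  qed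
  ultimately show ?thesis
    using f'c unfolding weak_homotopy_equivalence_def by blast
qed

text \<open>Two of the three cases of two-out-of-three. Given the weak equivalence \<open>v\<close>, they are elementary because the base
points at which \<open>v\<close> is needed are the points \<open>u a\<close>. The remaining case, which cancels \<open>u\<close>, would have to
move base points along paths.\<close>

lemma weak_homotopy_equivalence_comp_iff:
  assumes u: "continuous_map S T u" and v: "weak_homotopy_equivalence T U v"
  shows "weak_homotopy_equivalence S U (v \<circ> u) \<longleftrightarrow> weak_homotopy_equivalence S T u"
proof -
  have vc: "continuous_map T U v" using v by (simp add: weak_homotopy_equivalence_def)
  have vuc: "continuous_map S U (v \<circ> u)" by (rule continuous_map_compose[OF u vc])
  have "bij_betw (path_components_map T u) (path_components_of S) (path_components_of T) \<longleftrightarrow>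
      bij_betw (path_components_map U v \<circ> path_components_map T u) (path_components_of S) (path_components_of U)"
    by (rule bij_betw_comp_iff2)
       (use v path_components_map_in[OF u] in \<open>auto simp: weak_homotopy_equivalence_def\<close>)
  also have "\<dots> \<longleftrightarrow> bij_betw (path_components_map U (v \<circ> u)) (path_components_of S) (path_components_of U)"
    by (rule bij_betw_cong) (simp add: path_components_map_comp[OF u vc])
  finally have 0: "bij_betw (path_components_map T u) (path_components_of S) (path_components_of T) \<longleftrightarrow>
      bij_betw (path_components_map U (v \<circ> u)) (path_components_of S) (path_components_of U)" .
  have n: "bij_betw (homotopy_classes_map n T (u a) u) (homotopy_classes n S a) (homotopy_classes n T (u a)) \<longleftrightarrow>
      bij_betw (homotopy_classes_map n U ((v \<circ> u) a) (v \<circ> u)) (homotopy_classes n S a) (homotopy_classes n U ((v \<circ> u) a))"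
    if "1 \<le> n" "a \<in> topspace S" for n a
  proof -
    have ua: "u a \<in> topspace T" using continuous_map_image_subset_topspace[OF u] that(2) by blast
    have "bij_betw (homotopy_classes_map n T (u a) u) (homotopy_classes n S a) (homotopy_classes n T (u a)) \<longleftrightarrow>
        bij_betw (homotopy_classes_map n U (v (u a)) v \<circ> homotopy_classes_map n T (u a) u)
          (homotopy_classes n S a) (homotopy_classes n U (v (u a)))"
      by (rule bij_betw_comp_iff2)
         (use v ua that homotopy_classes_map_in[OF u] in \<open>auto simp: weak_homotopy_equivalence_def\<close>)
    also have "\<dots> \<longleftrightarrow> bij_betw (homotopy_classes_map n U ((v \<circ> u) a) (v \<circ> u))
        (homotopy_classes n S a) (homotopy_classes n U ((v \<circ> u) a))"
      unfolding o_apply[of v u a] by (rule bij_betw_cong, subst o_apply, rule homotopy_classes_map_comp[OF u vc])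
    finally show ?thesis .
  qed
  show ?thesis
    unfolding weak_homotopy_equivalence_def using 0 n u vuc by auto
qed

section \<open>Path spaces and trace spaces\<close>

lemma topspace_compact_open_paths: "topspace (compact_open_paths T) = {p. ext_path T p}"
proof -
  have "{p. ext_path T p} \<in> {{p. ext_path T p \<and> p ` K \<subseteq> U} | K U. compact K \<and> K \<subseteq> {0..1} \<and> openin T U}"
    by (rule CollectI, rule exI[of _ "{}"], rule exI[of _ "{}"]) simp
  then show ?thesis
    unfolding compact_open_paths_def topology_generated_by_topspace by blast
qed

lemma dpath_ext_path: "d_space X \<Longrightarrow> p \<in> dpaths X \<Longrightarrow> ext_path (dtop X) p"
  by (simp add: d_space_def)

lemma topspace_dpath_space: "d_space X \<Longrightarrow> topspace (dpath_space X) = dpaths X"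
  using dpath_ext_path by (auto simp: dpath_space_def topspace_compact_open_paths)

lemma dpath_in_topspace:
  assumes "d_space X" and "p \<in> dpaths X" and "t \<in> {0..1}"
  shows "p t \<in> topspace (dtop X)"
  using dpath_ext_path[OF assms(1,2)] assms(3)
  unfolding ext_path_def pathin_def continuous_map_def by auto

text \<open>The preimage of the subbasic set of paths that send \<open>K\<close> into \<open>U\<close> consists of the paths that send \<open>K\<close> into the
preimage of \<open>U\<close>.\<close>

lemma continuous_map_dpath_comp:
  assumes X: "d_space X" and Y: "d_space Y" and f: "dmap X Y f"
  shows "continuous_map (dpath_space X) (dpath_space Y) (\<lambda>p. restrict (f \<circ> p) {0..1})"
  unfolding dpath_space_def[of Y]
proof (rule continuous_map_into_subtopology)
  show "(\<lambda>p. restrict (f \<circ> p) {0..1}) \<in> topspace (dpath_space X) \<rightarrow> dpaths Y"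
    using f topspace_dpath_space[OF X] by (auto simp: dmap_def)
  show "continuous_map (dpath_space X) (compact_open_paths (dtop Y)) (\<lambda>p. restrict (f \<circ> p) {0..1})"
    unfolding compact_open_paths_def
  proof (rule continuous_on_generated_topo)
    fix W assume "W \<in> {{p. ext_path (dtop Y) p \<and> p ` K \<subseteq> U} | K U. compact K \<and> K \<subseteq> {0..1} \<and> openin (dtop Y) U}"
    then obtain K U where W: "W = {p. ext_path (dtop Y) p \<and> p ` K \<subseteq> U}"
        and K: "compact K" "K \<subseteq> {0..1}" and U: "openin (dtop Y) U" by blast
    define V where "V = {x \<in> topspace (dtop X). f x \<in> U}"
    have V: "openin (dtop X) V"
      using f U unfolding dmap_def V_def by (blast intro: openin_continuous_map_preimage)
    have "restrict (f \<circ> p) {0..1} \<in> W \<longleftrightarrow> ext_path (dtop X) p \<and> p ` K \<subseteq> V" if p: "p \<in> dpaths X" for p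
    proof -
      have "restrict (f \<circ> p) {0..1} \<in> dpaths Y" using f p by (auto simp: dmap_def)
      then have "ext_path (dtop Y) (restrict (f \<circ> p) {0..1})" by (rule dpath_ext_path[OF Y])
      moreover have "p t \<in> topspace (dtop X)" if "t \<in> K" for t
        using dpath_in_topspace[OF X p] K(2) that by blast
      moreover have "restrict (f \<circ> p) {0..1} ` K = f ` (p ` K)" using K(2) by (auto simp: image_image subset_iff)
      ultimately show ?thesis using dpath_ext_path[OF X p] by (auto simp: W V_def)
    qed
    then have eq: "(\<lambda>p. restrict (f \<circ> p) {0..1}) -` W \<inter> topspace (dpath_space X) =
        {p. ext_path (dtop X) p \<and> p ` K \<subseteq> V} \<inter> dpaths X"
      by (auto simp: topspace_dpath_space[OF X])
    have "openin (compact_open_paths (dtop X)) {p. ext_path (dtop X) p \<and> p ` K \<subseteq> V}"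
      unfolding compact_open_paths_def by (rule topology_generated_by_Basis) (use K V in blast)
    then show "openin (dpath_space X) ((\<lambda>p. restrict (f \<circ> p) {0..1}) -` W \<inter> topspace (dpath_space X))"
      unfolding eq unfolding dpath_space_def openin_subtopology by blast
  next
    have "ext_path (dtop Y) (restrict (f \<circ> p) {0..1})" if "p \<in> dpaths X" for p
      using dpath_ext_path[OF Y] f that by (auto simp: dmap_def)
    moreover have "\<Union>{{p. ext_path (dtop Y) p \<and> p ` K \<subseteq> U} | K U. compact K \<and> K \<subseteq> {0..1} \<and> openin (dtop Y) U}
        = {p. ext_path (dtop Y) p}"
      using topspace_compact_open_paths[of "dtop Y"]
      unfolding compact_open_paths_def topology_generated_by_topspace .
    ultimately show "(\<lambda>p. restrict (f \<circ> p) {0..1}) ` topspace (dpath_space X) \<subseteq>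
        \<Union>{{p. ext_path (dtop Y) p \<and> p ` K \<subseteq> U} | K U. compact K \<and> K \<subseteq> {0..1} \<and> openin (dtop Y) U}"
      by (auto simp: topspace_dpath_space[OF X])
  qed
qed

lemma reparam_comp:
  assumes f: "dmap X Y f" and r: "reparam X p q"
  shows "reparam Y (restrict (f \<circ> p) {0..1}) (restrict (f \<circ> q) {0..1})"
proof -
  obtain \<phi> where \<phi>: "continuous_on {0..1} \<phi>" "mono_on {0..1} \<phi>" "\<phi> 0 = 0" "\<phi> 1 = 1"
      "q = restrict (p \<circ> \<phi>) {0..1}" and p: "p \<in> dpaths X"
    using r unfolding reparam_def by blast
  have "\<phi> t \<in> {0..1}" if "t \<in> {0..1}" for t
    using mono_onD[OF \<phi>(2), of 0 t] mono_onD[OF \<phi>(2), of t 1] that \<phi>(3,4) by auto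
  then have "restrict (f \<circ> q) {0..1} = restrict (restrict (f \<circ> p) {0..1} \<circ> \<phi>) {0..1}"
    by (auto simp: \<phi>(5) fun_eq_iff restrict_def)
  then show ?thesis
    using f p \<phi> unfolding reparam_def dmap_def by blast
qed

lemma equivclp_reparam_comp:
  assumes f: "dmap X Y f" and "equivclp (reparam X) p q"
  shows "equivclp (reparam Y) (restrict (f \<circ> p) {0..1}) (restrict (f \<circ> q) {0..1})"
  using assms(2)
proof (induction rule: equivclp_induct)
  case (step y z)
  then show ?case
    using reparam_comp[OF f] equivclp_into_equivclp by metis
qed simp

lemma dtrace_eq_iff: "dtrace X p = dtrace X q \<longleftrightarrow> equivclp (reparam X) p q"
  unfolding dtrace_def using equivclp_sym equivclp_trans equivclp_refl by (metis (no_types, lifting) Collect_cong mem_Collect_eq)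

text \<open>Composition with a d-map respects reparametrization, so any path of a trace computes the image.\<close>

lemma trace_map_dtrace:
  assumes "dmap X Y f"
  shows "trace_map Y f (dtrace X p) = dtrace Y (restrict (f \<circ> p) {0..1})"
proof -
  have "dtrace Y (restrict (f \<circ> q) {0..1}) = dtrace Y (restrict (f \<circ> p) {0..1})" if "q \<in> dtrace X p" for q
    using that equivclp_reparam_comp[OF assms] equivclp_sym by (simp add: dtrace_eq_iff) (simp add: dtrace_def equivclp_sym)
  moreover have "p \<in> dtrace X p" by (simp add: dtrace_def)
  ultimately show ?thesis unfolding trace_map_def by blast
qed

lemma endpoints_dtrace: "endpoints (dtrace X p) = (p 0, p 1)"
proof -
  have "q 0 = p 0 \<and> q 1 = p 1" if "equivclp (reparam X) p q" for q
    using that by (induction rule: equivclp_induct) (auto simp: reparam_def)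
  then have "(\<lambda>p. (p 0, p 1)) ` dtrace X p = {(p 0, p 1)}"
    by (force simp: dtrace_def)
  then show ?thesis by (simp add: endpoints_def)
qed

lemma topspace_trace_space: "d_space X \<Longrightarrow> topspace (trace_space X) = dtrace X ` dpaths X"
  by (simp add: trace_space_def topspace_quotient_topology topspace_dpath_space)

lemma trace_spaceE:
  assumes "d_space X" and "\<sigma> \<in> topspace (trace_space X)"
  obtains p where "p \<in> dpaths X" and "\<sigma> = dtrace X p"
  using assms by (auto simp: topspace_trace_space)

lemma dmap_path: "dmap X Y f \<Longrightarrow> p \<in> dpaths X \<Longrightarrow> restrict (f \<circ> p) {0..1} \<in> dpaths Y"
  by (auto simp: dmap_def)

lemma endpoints_trace_map:
  assumes "d_space X" and "dmap X Y f" and "\<sigma> \<in> topspace (trace_space X)"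
  shows "endpoints (trace_map Y f \<sigma>) = map_prod f f (endpoints \<sigma>)"
  using assms(3) topspace_trace_space[OF assms(1)]
  by (auto simp: trace_map_dtrace[OF assms(2)] endpoints_dtrace)

lemma dmap_reach_pairs:
  assumes "dmap X Y f" and "(x, y) \<in> reach_pairs X"
  shows "(f x, f y) \<in> reach_pairs Y"
proof -
  obtain p where p: "p \<in> dpaths X" "p 0 = x" "p 1 = y" "x \<in> topspace (dtop X)" "y \<in> topspace (dtop X)"
    using assms(2) by (auto simp: reach_pairs_def dpaths_between_def)
  have "f x \<in> topspace (dtop Y)" "f y \<in> topspace (dtop Y)"
    using assms(1) p(4,5) continuous_map_image_subset_topspace unfolding dmap_def by blast+
  moreover have "restrict (f \<circ> p) {0..1} \<in> dpaths_between Y (f x) (f y)"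
    using dmap_path[OF assms(1) p(1)] p by (simp add: dpaths_between_def)
  ultimately show ?thesis by (auto simp: reach_pairs_def)
qed

lemma trace_map_cong:
  assumes X: "d_space X" and f: "dmap X Y f" "dmap X Y f'"
    and eq: "\<And>x. x \<in> topspace (dtop X) \<Longrightarrow> f x = f' x" and \<sigma>: "\<sigma> \<in> topspace (trace_space X)"
  shows "trace_map Y f \<sigma> = trace_map Y f' \<sigma>"
proof -
  obtain p where p: "p \<in> dpaths X" "\<sigma> = dtrace X p" using trace_spaceE[OF X \<sigma>] .
  have "restrict (f \<circ> p) {0..1} = restrict (f' \<circ> p) {0..1}"
    using dpath_in_topspace[OF X p(1)] eq by (auto simp: restrict_def fun_eq_iff)
  then show ?thesis by (simp add: p(2) trace_map_dtrace[OF f(1)] trace_map_dtrace[OF f(2)])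
qed

lemma dmap_comp:
  assumes "dmap X Y f" and "dmap Y Z k"
  shows "dmap X Z (k \<circ> f)"
proof -
  have "restrict (k \<circ> f \<circ> p) {0..1} = restrict (k \<circ> restrict (f \<circ> p) {0..1}) {0..1}" for p :: "real \<Rightarrow> 'a"
    by (auto simp: restrict_def fun_eq_iff)
  then show ?thesis
    using assms unfolding dmap_def by (auto intro: continuous_map_compose)
qed

lemma trace_map_comp:
  assumes X: "d_space X" and f: "dmap X Y f" and k: "dmap Y Z k" and \<sigma>: "\<sigma> \<in> topspace (trace_space X)"
  shows "trace_map Z k (trace_map Y f \<sigma>) = trace_map Z (k \<circ> f) \<sigma>"
proof -
  obtain p where p: "p \<in> dpaths X" "\<sigma> = dtrace X p" using trace_spaceE[OF X \<sigma>] .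
  have "restrict (k \<circ> f \<circ> p) {0..1} = restrict (k \<circ> restrict (f \<circ> p) {0..1}) {0..1}"
    by (auto simp: restrict_def fun_eq_iff)
  then show ?thesis
    by (simp add: p(2) trace_map_dtrace[OF f] trace_map_dtrace[OF k] trace_map_dtrace[OF dmap_comp[OF f k]])
qed

lemma dmap_cong:
  assumes X: "d_space X" and f: "dmap X Y f" and eq: "\<And>x. x \<in> topspace (dtop X) \<Longrightarrow> f x = f' x"
  shows "dmap X Y f'"
proof -
  have "restrict (f \<circ> p) {0..1} = restrict (f' \<circ> p) {0..1}" if "p \<in> dpaths X" for p
    using dpath_in_topspace[OF X that] eq by (auto simp: restrict_def fun_eq_iff)
  then show ?thesis
    using f eq continuous_map_eq unfolding dmap_def by (metis (no_types, lifting))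
qed

lemma continuous_map_trace_map:
  assumes X: "d_space X" and Y: "d_space Y" and f: "dmap X Y f"
  shows "continuous_map (trace_space X) (trace_space Y) (trace_map Y f)"
proof (rule continuous_compose_quotient_map)
  show "quotient_map (dpath_space X) (trace_space X) (dtrace X)"
    unfolding trace_space_def by (rule quotient_map_quotient_topology)
  have "continuous_map (dpath_space Y) (trace_space Y) (dtrace Y)"
    unfolding trace_space_def by (intro quotient_imp_continuous_map quotient_map_quotient_topology)
  from continuous_map_comp[OF continuous_map_dpath_comp[OF X Y f] this]
  show "continuous_map (dpath_space X) (trace_space Y) (trace_map Y f \<circ> dtrace X)"
    by (simp add: o_def trace_map_dtrace[OF f])
qed

lemma topspace_trace_fibre:
  "topspace (trace_fibre X x y) = {\<sigma> \<in> topspace (trace_space X). endpoints \<sigma> = (x, y)}"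
  by (auto simp: trace_fibre_def)

lemma continuous_map_trace_fibre:
  assumes X: "d_space X" and Y: "d_space Y" and f: "dmap X Y f"
  shows "continuous_map (trace_fibre X x y) (trace_fibre Y (f x) (f y)) (trace_map Y f)"
  unfolding trace_fibre_def[of Y]
proof (rule continuous_map_into_subtopology)
  show "continuous_map (trace_fibre X x y) (trace_space Y) (trace_map Y f)"
    unfolding trace_fibre_def by (intro continuous_map_from_subtopology continuous_map_trace_map assms)
qed (auto simp: topspace_trace_fibre endpoints_trace_map[OF X f])

lemma psp_cong:
  assumes X: "d_space X" and f: "psp X Y f" and eq: "\<And>x. x \<in> topspace (dtop X) \<Longrightarrow> f x = f' x"
  shows "psp X Y f'"
proof -
  have df: "dmap X Y f" using f by (simp add: psp_def)
  have df': "dmap X Y f'" by (rule dmap_cong[OF X df eq])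
  have "weak_homotopy_equivalence (trace_fibre X x y) (trace_fibre Y (f' x) (f' y)) (trace_map Y f')"
    if xy: "(x, y) \<in> reach_pairs X" for x y
  proof -
    have "weak_homotopy_equivalence (trace_fibre X x y) (trace_fibre Y (f x) (f y)) (trace_map Y f)"
      using f xy unfolding psp_def by auto
    then have "weak_homotopy_equivalence (trace_fibre X x y) (trace_fibre Y (f x) (f y)) (trace_map Y f')"
      by (rule weak_homotopy_equivalence_cong)
         (simp add: topspace_trace_fibre trace_map_cong[OF X df df' eq])
    moreover have "f x = f' x" "f y = f' y" using xy eq by (auto simp: reach_pairs_def)
    ultimately show ?thesis by simp
  qed
  then show ?thesis using df' unfolding psp_def by auto
qed

text \<open>For \<open>k = h\<close> the direction from left to right shows that \<open>g\<close> is psp if \<open>h \<circ> g\<close> and \<open>h\<close> are; for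
\<open>k = L\<^sub>t\<close> the other direction shows that \<open>L\<^sub>t \<circ> g\<close> is psp.\<close>

lemma psp_comp_iff:
  assumes X: "d_space X" and Y: "d_space Y" and Z: "d_space Z"
    and f: "dmap X Y f" and k: "psp Y Z k"
  shows "psp X Z (k \<circ> f) \<longleftrightarrow> psp X Y f"
proof -
  have dk: "dmap Y Z k" using k by (simp add: psp_def)
  have "weak_homotopy_equivalence (trace_fibre X x y) (trace_fibre Z (k (f x)) (k (f y))) (trace_map Z (k \<circ> f)) \<longleftrightarrow>
      weak_homotopy_equivalence (trace_fibre X x y) (trace_fibre Y (f x) (f y)) (trace_map Y f)"
    if xy: "(x, y) \<in> reach_pairs X" for x y
  proof -
    have comp: "trace_map Z k (trace_map Y f \<sigma>) = trace_map Z (k \<circ> f) \<sigma>"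
      if "\<sigma> \<in> topspace (trace_fibre X x y)" for \<sigma>
      using that trace_map_comp[OF X f dk] by (simp add: topspace_trace_fibre)
    have "weak_homotopy_equivalence (trace_fibre X x y) U (trace_map Z k \<circ> trace_map Y f) \<longleftrightarrow>
        weak_homotopy_equivalence (trace_fibre X x y) U (trace_map Z (k \<circ> f))" for U
      by (rule iffI; erule weak_homotopy_equivalence_cong) (simp_all add: comp)
    moreover
    have "weak_homotopy_equivalence (trace_fibre Y (f x) (f y)) (trace_fibre Z (k (f x)) (k (f y))) (trace_map Z k)"
      using k dmap_reach_pairs[OF f xy] unfolding psp_def by auto
    ultimately show ?thesis
      using weak_homotopy_equivalence_comp_iff[OF continuous_map_trace_fibre[OF X Y f]] by blast
  qed
  then show ?thesis using f dmap_comp[OF f dk] unfolding psp_def by auto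
qed

section \<open>Pullbacks of fibre homotopy equivalences\<close>

lemma topspace_pullback_space:
  "topspace (pullback_space B f E p) = {(b, e). b \<in> topspace B \<and> e \<in> topspace E \<and> f b = p e}"
  by (auto simp: pullback_space_def)

lemma continuous_map_into_pullback_space:
  assumes "continuous_map Z B u" and "continuous_map Z E w"
    and "\<And>z. z \<in> topspace Z \<Longrightarrow> f (u z) = p (w z)"
  shows "continuous_map Z (pullback_space B f E p) (\<lambda>z. (u z, w z))"
  unfolding pullback_space_def
  by (intro continuous_map_into_subtopology continuous_map_pairedI assms) (auto simp: assms)

lemma continuous_map_pullback_fst: "continuous_map (pullback_space B f E p) B fst"
  unfolding pullback_space_def by (rule continuous_map_subtopology_fst)

lemma continuous_map_pullback_snd: "continuous_map (pullback_space B f E p) E snd"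
  unfolding pullback_space_def by (rule continuous_map_subtopology_snd)

lemma pullback_fibre_map:
  assumes k: "fibre_map E p E' p' k"
  shows "fibre_map (pullback_space B f E p) fst (pullback_space B f E' p') fst (\<lambda>z. (fst z, k (snd z)))"
  unfolding fibre_map_def
  using k fibre_mapD[OF k]
  by (auto simp: fibre_map_def topspace_pullback_space
       intro!: continuous_map_into_pullback_space continuous_map_pullback_fst
         continuous_map_comp[OF continuous_map_pullback_snd])

lemma pullback_fibre_homotopic:
  assumes "fibre_homotopic E p E' p' k k'"
  shows "fibre_homotopic (pullback_space B f E p) fst (pullback_space B f E' p') fst
    (\<lambda>z. (fst z, k (snd z))) (\<lambda>z. (fst z, k' (snd z)))"
proof -
  obtain h where h: "continuous_map (prod_topology (top_of_set {0..1::real}) E) E' h"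
      "\<And>e. e \<in> topspace E \<Longrightarrow> h (0, e) = k e" "\<And>e. e \<in> topspace E \<Longrightarrow> h (1, e) = k' e"
      "\<And>r e. 0 \<le> r \<Longrightarrow> r \<le> 1 \<Longrightarrow> e \<in> topspace E \<Longrightarrow> h (r, e) \<in> topspace E' \<and> p' (h (r, e)) = p e"
    using fibre_homotopicE[OF assms] by blast
  let ?Z = "prod_topology (top_of_set {0..1::real}) (pullback_space B f E p)"
  have s: "continuous_map ?Z (pullback_space B f E p) snd" by (rule continuous_map_snd)
  show ?thesis
  proof (rule fibre_homotopicI[where h = "\<lambda>r z. (fst z, h (r, snd z))"])
    show "continuous_map ?Z (pullback_space B f E' p') (\<lambda>z. (fst (snd z), h (fst z, snd (snd z))))"
      by (intro continuous_map_into_pullback_space continuous_map_comp[OF s continuous_map_pullback_fst]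
            continuous_map_comp[OF _ h(1)] continuous_map_pairedI continuous_map_fst
            continuous_map_comp[OF s continuous_map_pullback_snd])
         (auto simp: topspace_pullback_space h(4))
  qed (auto simp: topspace_pullback_space h)
qed

lemma pullback_fibre_homotopy_equivalence:
  assumes "fibre_homotopy_equivalence E p E' p' k"
  shows "fibre_homotopy_equivalence (pullback_space B f E p) fst (pullback_space B f E' p') fst
    (\<lambda>z. (fst z, k (snd z)))"
proof -
  obtain l where l: "fibre_map E p E' p' k" "fibre_map E' p' E p l"
      "fibre_homotopic E p E p (l \<circ> k) id" "fibre_homotopic E' p' E' p' (k \<circ> l) id"
    using fibre_homotopy_equivalenceE[OF assms] by blast
  show ?thesis
    by (rule fibre_homotopy_equivalenceI[OF pullback_fibre_map[OF l(1)] pullback_fibre_map[OF l(2)]])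
       (use pullback_fibre_homotopic[OF l(3), of B f] pullback_fibre_homotopic[OF l(4), of B f]
         in \<open>simp_all add: o_def id_def\<close>)
qed

lemma fibre_homeomorphism_imp_equivalence:
  assumes f: "fibre_map E p E' p' f" and g: "fibre_map E' p' E p g"
    and "\<And>e. e \<in> topspace E \<Longrightarrow> g (f e) = e" and "\<And>e. e \<in> topspace E' \<Longrightarrow> f (g e) = e"
  shows "fibre_homotopy_equivalence E p E' p' f"
  by (rule fibre_homotopy_equivalenceI[OF f g])
     (use assms in \<open>auto intro!: fibre_homotopic_equal fibre_map_comp\<close>)

lemma pullback_space_cong:
  assumes "\<And>b. b \<in> topspace B \<Longrightarrow> f b = f' b"
  shows "pullback_space B f E p = pullback_space B f' E p"
proof -
  have "topspace (prod_topology B E) \<inter> {(b, e). f b = p e} = topspace (prod_topology B E) \<inter> {(b, e). f' b = p e}"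
    using assms by auto
  then show ?thesis unfolding pullback_space_def by (metis subtopology_restrict)
qed

lemma over_pullback_space: "over (pullback_space B f E p) fst S = pullback_space (subtopology B S) f E p"
proof -
  have "topspace (prod_topology B E) \<inter> ({(b, e). f b = p e} \<inter> {z. fst z \<in> S}) =
      topspace (prod_topology B E) \<inter> (S \<times> topspace E \<inter> {(b, e). f b = p e})"
    by auto
  then show ?thesis
    unfolding over_def pullback_space_def prod_topology_subtopology subtopology_subtopology
    by (metis subtopology_restrict)
qed

text \<open>A pullback of a pullback is the pullback along the composite.\<close>

lemma pullback_space_pasting:
  assumes \<theta>: "continuous_map B0 B \<theta>"
  shows "fibre_homotopy_equivalence (pullback_space B0 \<theta> (pullback_space B f E p) fst) fst
    (pullback_space B0 (f \<circ> \<theta>) E p) fst (\<lambda>z. (fst z, snd (snd z)))"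
proof (rule fibre_homeomorphism_imp_equivalence[where g = "\<lambda>z. (fst z, (\<theta> (fst z), snd z))"])
  show "fibre_map (pullback_space B0 \<theta> (pullback_space B f E p) fst) fst
      (pullback_space B0 (f \<circ> \<theta>) E p) fst (\<lambda>z. (fst z, snd (snd z)))"
    unfolding fibre_map_def
    by (auto simp: topspace_pullback_space intro!: continuous_map_into_pullback_space
         continuous_map_pullback_fst continuous_map_comp[OF continuous_map_pullback_snd] continuous_map_pullback_snd)
  show "fibre_map (pullback_space B0 (f \<circ> \<theta>) E p) fst
      (pullback_space B0 \<theta> (pullback_space B f E p) fst) fst (\<lambda>z. (fst z, (\<theta> (fst z), snd z)))"
    unfolding fibre_map_def
    by (auto simp: topspace_pullback_space intro!: continuous_map_into_pullback_space
         continuous_map_pullback_fst continuous_map_comp[OF continuous_map_pullback_fst \<theta>] continuous_map_pullback_snd)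
qed (auto simp: topspace_pullback_space)

section \<open>Coherently psp homotopies over an arbitrary base\<close>

lemma psp_homotopy_psp: "psp_homotopy X H \<Longrightarrow> t \<in> {0..1} \<Longrightarrow> psp X X (\<lambda>x. H (x, t))"
  by (simp add: psp_homotopy_def)

lemma psp_homotopy_dmap: "psp_homotopy X H \<Longrightarrow> t \<in> {0..1} \<Longrightarrow> dmap X X (\<lambda>x. H (x, t))"
  by (simp add: psp_homotopy_def psp_def)

lemma psp_homotopy_continuous:
  "psp_homotopy X H \<Longrightarrow> continuous_map (prod_topology (dtop X) (top_of_set {0..1})) (dtop X) H"
  by (simp add: psp_homotopy_def neutral_dhomotopy_def dmap_def dprod_def neutral_interval_def)

text \<open>A d-path of the product with the neutral interval has a constant second component, so each of them is moved by a
single map of the family.\<close>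

lemma neutral_dhomotopyI:
  assumes c: "continuous_map (prod_topology (dtop X) (top_of_set {0..1})) (dtop X) H"
    and d: "\<And>t. t \<in> {0..1} \<Longrightarrow> dmap X X (\<lambda>x. H (x, t))"
  shows "neutral_dhomotopy X H"
proof -
  have "restrict (H \<circ> p) {0..1} \<in> dpaths X"
    if p: "restrict (fst \<circ> p) {0..1} \<in> dpaths X" "restrict (snd \<circ> p) {0..1} = restrict (\<lambda>_. s) {0..1}" "s \<in> {0..1}" for p s
  proof -
    have "snd (p t) = s" if "t \<in> {0..1}" for t
      using fun_cong[OF p(2), of t] that by simp
    then have "restrict (H \<circ> p) {0..1} = restrict ((\<lambda>x. H (x, s)) \<circ> restrict (fst \<circ> p) {0..1}) {0..1}"
      by (auto simp: restrict_def fun_eq_iff) (metis prod.collapse)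
    then show ?thesis using dmap_path[OF d[OF p(3)] p(1)] by simp
  qed
  then show ?thesis
    using c unfolding neutral_dhomotopy_def dmap_def dprod_def neutral_interval_def by auto
qed

text \<open>The base of the end point map, that is, the first factor of \<open>reach_base\<close>.\<close>

definition reach_space :: "'a dstruct \<Rightarrow> ('a \<times> 'a) topology" where
  "reach_space X = subtopology (prod_topology (dtop X) (dtop X)) (reach_pairs X)"

lemma topspace_reach_space: "topspace (reach_space X) = reach_pairs X"
  by (auto simp: reach_space_def reach_pairs_def)

lemma reach_base_eq: "reach_base X = prod_topology (reach_space X) (top_of_set {0..1})"
  by (simp add: reach_base_def reach_space_def)

lemma continuous_map_reach_space:
  assumes f: "dmap X X f"
  shows "continuous_map (reach_space X) (reach_space X) (map_prod f f)"
proof -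
  have c: "continuous_map (dtop X) (dtop X) f" using f by (simp add: dmap_def)
  have "continuous_map (reach_space X) (prod_topology (dtop X) (dtop X)) (\<lambda>z. (f (fst z), f (snd z)))"
    unfolding reach_space_def
    by (intro continuous_map_pairedI continuous_map_comp[OF _ c] continuous_intros)
  then have "continuous_map (reach_space X) (reach_space X) (\<lambda>z. (f (fst z), f (snd z)))"
    unfolding reach_space_def[of X]
    by (intro continuous_map_into_subtopology) (auto simp: dmap_reach_pairs[OF f])
  then show ?thesis by (simp add: map_prod_def case_prod_unfold)
qed

text \<open>Coherence of \<open>L\<close> is an equivalence over the universal base of triples \<open>(x, y, t)\<close> with \<open>x \<preceq> y\<close>. Pulling it back along
\<open>(\<gamma>, \<beta>)\<close> yields equivalences for everything that is a reparametrization of \<open>L\<close>: its restriction to a single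
time (constant \<open>\<beta>\<close>), its precomposition with a d-map (through \<open>\<gamma>\<close>), and its reversal or a change of speed
(through \<open>\<beta>\<close>).\<close>

lemma coherent_pullback_equivalence:
  assumes X: "d_space X" and L: "coherently_psp_homotopy X L"
    and \<gamma>: "continuous_map B (reach_space X) \<gamma>"
    and \<beta>: "continuous_map B euclideanreal \<beta>" "\<And>b. b \<in> topspace B \<Longrightarrow> 0 \<le> \<beta> b \<and> \<beta> b \<le> 1"
  shows "fibre_homotopy_equivalence (pullback_space B \<gamma> (trace_space X) endpoints) fst
    (pullback_space B (\<lambda>b. homotopy_square L (\<gamma> b, \<beta> b)) (trace_space X) endpoints) fst
    (\<lambda>z. (fst z, trace_map X (\<lambda>x. L (x, \<beta> (fst z))) (snd z)))"
proof -
  let ?I = "top_of_set {0..1::real}"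
  let ?T = "trace_space X"
  let ?p = "\<lambda>(\<sigma>, t). (endpoints \<sigma>, t)"
  let ?\<theta> = "\<lambda>b. (\<gamma> b, \<beta> b)"
  have \<beta>I: "continuous_map B ?I \<beta>" by (rule continuous_map_unit_interval[OF \<beta>])
  have \<theta>: "continuous_map B (reach_base X) ?\<theta>"
    unfolding reach_base_eq by (intro continuous_map_pairedI \<gamma> \<beta>I)
  have "fibre_homotopy_equivalence (pullback_space B \<gamma> ?T endpoints) fst
      (pullback_space B ?\<theta> (prod_topology ?T ?I) ?p) fst (\<lambda>z. (fst z, (snd z, \<beta> (fst z))))"
  proof (rule fibre_homeomorphism_imp_equivalence[where g = "\<lambda>z. (fst z, fst (snd z))"])
    show "fibre_map (pullback_space B \<gamma> ?T endpoints) fst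
      (pullback_space B ?\<theta> (prod_topology ?T ?I) ?p) fst (\<lambda>z. (fst z, (snd z, \<beta> (fst z))))"
      unfolding fibre_map_def
      by (auto simp: topspace_pullback_space intro!: continuous_map_into_pullback_space
          continuous_map_pullback_fst continuous_map_pairedI continuous_map_pullback_snd
          continuous_map_comp[OF continuous_map_pullback_fst \<beta>I])
    show "fibre_map (pullback_space B ?\<theta> (prod_topology ?T ?I) ?p) fst
      (pullback_space B \<gamma> ?T endpoints) fst (\<lambda>z. (fst z, fst (snd z)))"
      unfolding fibre_map_def
      by (auto simp: topspace_pullback_space intro!: continuous_map_into_pullback_space
          continuous_map_pullback_fst continuous_map_comp[OF continuous_map_pullback_snd continuous_map_fst])
  qed (auto simp: topspace_pullback_space)
  from fibre_homotopy_equivalence_comp[OF fibre_homotopy_equivalence_comp[OF this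
        pullback_fibre_homotopy_equivalence] pullback_space_pasting[OF \<theta>]]
    L
  have "fibre_homotopy_equivalence (pullback_space B \<gamma> ?T endpoints) fst
    (pullback_space B (homotopy_square L \<circ> ?\<theta>) ?T endpoints) fst
    ((\<lambda>z. (fst z, snd (snd z))) \<circ>
      ((\<lambda>z. (fst z, (\<lambda>(\<sigma>, t). ((endpoints \<sigma>, t), trace_map X (\<lambda>x. L (x, t)) \<sigma>)) (snd z))) \<circ>
       (\<lambda>z. (fst z, (snd z, \<beta> (fst z))))))"
    unfolding coherently_psp_homotopy_def by blast
  then show ?thesis by (simp add: o_def)
qed

section \<open>The homotopy from the identity to g\<close>

text \<open>The homotopy \<open>K\<close> followed by the reverse of \<open>L \<circ> g\<close>. It rests for \<open>1/5 \<le> t \<le> 4/5\<close>, so that it coincides with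
a reparametrization of \<open>K\<close> up to \<open>4/5\<close> and with one of \<open>L \<circ> g\<close> from \<open>1/5\<close> on. The gluing theorem
requires this overlap.\<close>

definition concat_homotopy ::
    "('a \<Rightarrow> 'a) \<Rightarrow> ('a \<times> real \<Rightarrow> 'a) \<Rightarrow> ('a \<times> real \<Rightarrow> 'a) \<Rightarrow> 'a \<times> real \<Rightarrow> 'a" where
  "concat_homotopy g K L = (\<lambda>(x, t).
     if t \<le> 1/2 then K (x, clamp01 (5 * t)) else L (g x, clamp01 (5 * (1 - t))))"

locale homotopies_to_composite =
  fixes X :: "'a dstruct" and g h :: "'a \<Rightarrow> 'a" and K L :: "'a \<times> real \<Rightarrow> 'a"
  assumes X: "d_space X" and g: "dmap X X g"
    and K: "psp_homotopy X K" and K_ends: "\<And>x. x \<in> topspace (dtop X) \<Longrightarrow> K (x, 0) = x \<and> K (x, 1) = h (g x)"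
    and L: "psp_homotopy X L" and L_ends: "\<And>x. x \<in> topspace (dtop X) \<Longrightarrow> L (x, 0) = x \<and> L (x, 1) = h x"
begin

abbreviation H :: "'a \<times> real \<Rightarrow> 'a" where
  "H \<equiv> concat_homotopy g K L"

lemma g_in_topspace: "x \<in> topspace (dtop X) \<Longrightarrow> g x \<in> topspace (dtop X)"
  using g continuous_map_image_subset_topspace unfolding dmap_def by blast

lemma H_early: "x \<in> topspace (dtop X) \<Longrightarrow> t \<le> 4/5 \<Longrightarrow> H (x, t) = K (x, clamp01 (5 * t))"
  by (simp add: concat_homotopy_def K_ends L_ends g_in_topspace)

lemma H_late: "x \<in> topspace (dtop X) \<Longrightarrow> 1/5 \<le> t \<Longrightarrow> H (x, t) = L (g x, clamp01 (5 * (1 - t)))"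
  by (simp add: concat_homotopy_def K_ends L_ends g_in_topspace)

lemma g_psp: "psp X X g"
proof -
  have "psp X X (\<lambda>x. L (x, 1))" "psp X X (\<lambda>x. K (x, 1))"
    using psp_homotopy_psp[OF L, of 1] psp_homotopy_psp[OF K, of 1] by auto
  moreover have "psp X X ((\<lambda>x. L (x, 1)) \<circ> g)"
    by (rule psp_cong[OF X \<open>psp X X (\<lambda>x. K (x, 1))\<close>]) (simp add: K_ends L_ends g_in_topspace)
  ultimately show ?thesis
    using psp_comp_iff[OF X X X g] by blast
qed

lemma H_psp:
  assumes t: "t \<in> {0..1}"
  shows "psp X X (\<lambda>x. H (x, t))"
proof (cases "t \<le> 4/5")
  case True
  have "psp X X (\<lambda>x. K (x, clamp01 (5 * t)))"
    by (rule psp_homotopy_psp[OF K]) simp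
  then show ?thesis by (rule psp_cong[OF X]) (rule H_early[OF _ True, symmetric])
next
  case False
  have "psp X X (\<lambda>x. L (x, clamp01 (5 * (1 - t))))"
    by (rule psp_homotopy_psp[OF L]) simp
  then have "psp X X ((\<lambda>x. L (x, clamp01 (5 * (1 - t)))) \<circ> g)"
    using psp_comp_iff[OF X X X g] g_psp by blast
  then show ?thesis by (rule psp_cong[OF X]) (use False in \<open>simp add: H_late\<close>)
qed

lemma H_continuous: "continuous_map (prod_topology (dtop X) (top_of_set {0..1})) (dtop X) H"
proof -
  let ?P = "prod_topology (dtop X) (top_of_set {0..1::real})"
  have t: "continuous_map ?P euclideanreal snd"
    using continuous_map_snd continuous_map_into_fulltopology by blast
  have cg: "continuous_map (dtop X) (dtop X) g" using g by (simp add: dmap_def)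
  have "continuous_map ?P (dtop X)
      (\<lambda>z. if snd z \<le> 1/2 then K (fst z, clamp01 (5 * snd z)) else L (g (fst z), clamp01 (5 * (1 - snd z))))"
  proof (rule continuous_map_glue_le[OF t])
    have "continuous_map ?P (dtop X) (\<lambda>z. K (fst z, clamp01 (5 * snd z)))"
      by (rule continuous_map_comp[OF _ psp_homotopy_continuous[OF K]])
         (auto intro!: continuous_map_pairedI continuous_map_fst continuous_map_unit_interval continuous_intros t)
    then show "continuous_map (subtopology ?P {z. snd z \<le> 1/2}) (dtop X) (\<lambda>z. K (fst z, clamp01 (5 * snd z)))"
      by (rule continuous_map_from_subtopology)
    have "continuous_map ?P (dtop X) (\<lambda>z. L (g (fst z), clamp01 (5 * (1 - snd z))))"
      by (rule continuous_map_comp[OF _ psp_homotopy_continuous[OF L]])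
         (auto intro!: continuous_map_pairedI continuous_map_comp[OF continuous_map_fst cg]
            continuous_map_unit_interval continuous_intros t)
    then show "continuous_map (subtopology ?P {z. 1/2 \<le> snd z}) (dtop X) (\<lambda>z. L (g (fst z), clamp01 (5 * (1 - snd z))))"
      by (rule continuous_map_from_subtopology)
  qed (auto simp: K_ends L_ends g_in_topspace)
  then show ?thesis by (simp add: concat_homotopy_def case_prod_unfold)
qed

lemma H_psp_homotopy: "psp_homotopy X H"
  unfolding psp_homotopy_def
  using H_psp by (auto intro!: neutral_dhomotopyI H_continuous simp: psp_def)

lemma H_ends: "x \<in> topspace (dtop X) \<Longrightarrow> H (x, 0) = x \<and> H (x, 1) = g x"
  by (simp add: H_early H_late K_ends L_ends g_in_topspace)

text \<open>Over \<open>t \<le> 4/5\<close> the comparison map of \<open>H\<close> is pulled back from that of \<open>K\<close>. Over \<open>t \<ge> 1/5\<close> it is the comparison map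
of \<open>g\<close> followed by a pullback of that of \<open>L\<close>. The comparison map of \<open>g\<close> is itself an equivalence by
two-out-of-three: followed by the comparison map of \<open>h = L\<^sub>1\<close> it becomes that of \<open>h \<circ> g = K\<^sub>1\<close>. The gluing theorem
combines the two parts. For a uniform description over the base, all this is done for the pullback \<open>?E\<close> of the end
point map along the projection, which is homeomorphic to the product of the trace space with the interval.\<close>

lemma H_coherent:
  assumes cK: "coherently_psp_homotopy X K" and cL: "coherently_psp_homotopy X L"
  shows "coherently_psp_homotopy X H"
proof -
  let ?I = "top_of_set {0..1::real}"
  let ?T = "trace_space X"
  let ?B = "reach_base X"
  let ?E = "pullback_space ?B fst ?T endpoints"
  let ?E' = "pullback_space ?B (homotopy_square H) ?T endpoints"
  let ?F = "\<lambda>z. (fst z, trace_map X (\<lambda>x. H (x, snd (fst z))) (snd z))"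
  have snd_real: "continuous_map ?B euclideanreal snd"
    unfolding reach_base_eq using continuous_map_snd continuous_map_into_fulltopology by blast
  have topB: "topspace ?B = reach_pairs X \<times> {0..1}"
    by (simp add: reach_base_eq topspace_reach_space)
  have reach_top: "x \<in> topspace (dtop X)" "y \<in> topspace (dtop X)" if "(x, y) \<in> reach_pairs X" for x y
    using that by (auto simp: reach_pairs_def)
  have H_dmap: "dmap X X (\<lambda>x. H (x, t))" if "t \<in> {0..1}" for t
    using psp_homotopy_dmap[OF H_psp_homotopy that] .
  have fst_reach: "continuous_map (subtopology ?B S) (reach_space X) fst" for S
    unfolding reach_base_eq by (intro continuous_map_from_subtopology continuous_map_fst)
  have snd_real': "continuous_map (subtopology ?B S) euclideanreal snd" for S
    by (intro continuous_map_from_subtopology snd_real)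

  have lo: "fibre_homotopy_equivalence (over ?E fst {b. snd b \<le> 4/5}) fst (over ?E' fst {b. snd b \<le> 4/5}) fst ?F"
  proof -
    let ?B0 = "subtopology ?B {b. snd b \<le> 4/5}"
    let ?\<alpha> = "\<lambda>b. clamp01 (5 * snd b)"
    have "fibre_homotopy_equivalence (pullback_space ?B0 fst ?T endpoints) fst
        (pullback_space ?B0 (\<lambda>b. homotopy_square K (fst b, ?\<alpha> b)) ?T endpoints) fst
        (\<lambda>z. (fst z, trace_map X (\<lambda>x. K (x, ?\<alpha> (fst z))) (snd z)))"
      by (rule coherent_pullback_equivalence[OF X cK fst_reach])
         (auto intro!: continuous_intros snd_real')
    moreover have "pullback_space ?B0 (\<lambda>b. homotopy_square K (fst b, ?\<alpha> b)) ?T endpoints =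
        pullback_space ?B0 (homotopy_square H) ?T endpoints"
      by (rule pullback_space_cong)
         (auto simp: homotopy_square_def topB H_early reach_top)
    ultimately have "fibre_homotopy_equivalence (pullback_space ?B0 fst ?T endpoints) fst
        (pullback_space ?B0 (homotopy_square H) ?T endpoints) fst
        (\<lambda>z. (fst z, trace_map X (\<lambda>x. K (x, ?\<alpha> (fst z))) (snd z)))"
      by simp
    then show ?thesis
      unfolding over_pullback_space
    proof (rule fibre_homotopy_equivalence_cong)
      fix z assume "z \<in> topspace (pullback_space ?B0 fst ?T endpoints)"
      then have z: "snd z \<in> topspace ?T" "snd (fst z) \<in> {0..1}" "snd (fst z) \<le> 4/5"
        by (auto simp: topspace_pullback_space topB)
      have dK: "dmap X X (\<lambda>x. K (x, ?\<alpha> (fst z)))"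
        by (rule psp_homotopy_dmap[OF K]) simp
      have "trace_map X (\<lambda>x. K (x, ?\<alpha> (fst z))) (snd z) = trace_map X (\<lambda>x. H (x, snd (fst z))) (snd z)"
        by (rule trace_map_cong[OF X dK H_dmap[OF z(2)] _ z(1)]) (use z(3) in \<open>simp add: H_early\<close>)
      then show "(fst z, trace_map X (\<lambda>x. K (x, ?\<alpha> (fst z))) (snd z)) = ?F z"
        by simp
    qed
  qed

  have hi: "fibre_homotopy_equivalence (over ?E fst {b. 1/5 \<le> snd b}) fst (over ?E' fst {b. 1/5 \<le> snd b}) fst ?F"
  proof -
    let ?B0 = "subtopology ?B {b. 1/5 \<le> snd b}"
    let ?\<beta> = "\<lambda>b. clamp01 (5 * (1 - snd b))"
    let ?\<gamma> = "\<lambda>b. map_prod g g (fst b)"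
    let ?E0 = "pullback_space ?B0 fst ?T endpoints"
    let ?M = "pullback_space ?B0 ?\<gamma> ?T endpoints"
    let ?G = "\<lambda>z. (fst z, trace_map X g (snd z))"
    have \<gamma>: "continuous_map ?B0 (reach_space X) ?\<gamma>"
      by (rule continuous_map_comp[OF fst_reach continuous_map_reach_space[OF g]])
    have G: "fibre_map ?E0 fst ?M fst ?G"
      unfolding fibre_map_def
      by (auto simp: topspace_pullback_space endpoints_trace_map[OF X g]
          intro!: continuous_map_into_pullback_space continuous_map_pullback_fst
            continuous_map_comp[OF continuous_map_pullback_snd continuous_map_trace_map[OF X X g]])
    have G_equiv: "fibre_homotopy_equivalence ?E0 fst ?M fst ?G"
    proof (rule fibre_homotopy_equivalence_cancel_left[OF G])
      let ?N = "pullback_space ?B0 (\<lambda>b. homotopy_square L (?\<gamma> b, 1)) ?T endpoints"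
      show "fibre_homotopy_equivalence ?M fst ?N fst (\<lambda>z. (fst z, trace_map X (\<lambda>x. L (x, 1)) (snd z)))"
        by (rule coherent_pullback_equivalence[OF X cL \<gamma>]) auto
      have "fibre_homotopy_equivalence ?E0 fst
          (pullback_space ?B0 (\<lambda>b. homotopy_square K (fst b, 1)) ?T endpoints) fst
          (\<lambda>z. (fst z, trace_map X (\<lambda>x. K (x, 1)) (snd z)))"
        by (rule coherent_pullback_equivalence[OF X cK fst_reach]) auto
      moreover have "pullback_space ?B0 (\<lambda>b. homotopy_square K (fst b, 1)) ?T endpoints = ?N"
        by (rule pullback_space_cong)
           (auto simp: homotopy_square_def topB K_ends L_ends g_in_topspace reach_top)
      ultimately have "fibre_homotopy_equivalence ?E0 fst ?N fst
          (\<lambda>z. (fst z, trace_map X (\<lambda>x. K (x, 1)) (snd z)))"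
        by simp
      then show "fibre_homotopy_equivalence ?E0 fst ?N fst
          ((\<lambda>z. (fst z, trace_map X (\<lambda>x. L (x, 1)) (snd z))) \<circ> ?G)"
      proof (rule fibre_homotopy_equivalence_cong)
        fix z assume "z \<in> topspace ?E0"
        then have z: "snd z \<in> topspace ?T" by (auto simp: topspace_pullback_space)
        have dK: "dmap X X (\<lambda>x. K (x, 1))" and dL: "dmap X X (\<lambda>x. L (x, 1))"
          using psp_homotopy_dmap[OF K] psp_homotopy_dmap[OF L] by auto
        have "trace_map X (\<lambda>x. K (x, 1)) (snd z) = trace_map X ((\<lambda>x. L (x, 1)) \<circ> g) (snd z)"
          by (rule trace_map_cong[OF X dK dmap_comp[OF g dL] _ z]) (simp add: K_ends L_ends g_in_topspace)
        then show "(fst z, trace_map X (\<lambda>x. K (x, 1)) (snd z)) =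
            ((\<lambda>z. (fst z, trace_map X (\<lambda>x. L (x, 1)) (snd z))) \<circ> ?G) z"
          by (simp add: trace_map_comp[OF X g dL z])
      qed
    qed
    have "fibre_homotopy_equivalence ?M fst
        (pullback_space ?B0 (\<lambda>b. homotopy_square L (?\<gamma> b, ?\<beta> b)) ?T endpoints) fst
        (\<lambda>z. (fst z, trace_map X (\<lambda>x. L (x, ?\<beta> (fst z))) (snd z)))"
      by (rule coherent_pullback_equivalence[OF X cL \<gamma>]) (auto intro!: continuous_intros snd_real')
    moreover have "pullback_space ?B0 (\<lambda>b. homotopy_square L (?\<gamma> b, ?\<beta> b)) ?T endpoints =
        pullback_space ?B0 (homotopy_square H) ?T endpoints"
      by (rule pullback_space_cong)
         (auto simp: homotopy_square_def topB H_late reach_top)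
    ultimately have "fibre_homotopy_equivalence ?E0 fst (pullback_space ?B0 (homotopy_square H) ?T endpoints) fst
        ((\<lambda>z. (fst z, trace_map X (\<lambda>x. L (x, ?\<beta> (fst z))) (snd z))) \<circ> ?G)"
      using fibre_homotopy_equivalence_comp[OF G_equiv] by simp
    then show ?thesis
      unfolding over_pullback_space
    proof (rule fibre_homotopy_equivalence_cong)
      fix z assume "z \<in> topspace ?E0"
      then have z: "snd z \<in> topspace ?T" "snd (fst z) \<in> {0..1}" "1/5 \<le> snd (fst z)"
        by (auto simp: topspace_pullback_space topB)
      have dL: "dmap X X (\<lambda>x. L (x, ?\<beta> (fst z)))"
        by (rule psp_homotopy_dmap[OF L]) simp
      have "trace_map X ((\<lambda>x. L (x, ?\<beta> (fst z))) \<circ> g) (snd z) = trace_map X (\<lambda>x. H (x, snd (fst z))) (snd z)"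
        by (rule trace_map_cong[OF X dmap_comp[OF g dL] H_dmap[OF z(2)] _ z(1)]) (use z(3) in \<open>simp add: H_late\<close>)
      then show "((\<lambda>z. (fst z, trace_map X (\<lambda>x. L (x, ?\<beta> (fst z))) (snd z))) \<circ> ?G) z = ?F z"
        by (simp only: o_apply fst_conv snd_conv trace_map_comp[OF X g dL z(1)])
    qed
  qed

  have F: "fibre_homotopy_equivalence ?E fst ?E' fst ?F"
    by (rule fibre_homotopy_equivalence_glue[where \<tau> = snd, OF _ _ _ lo hi])
       (simp, (rule continuous_map_comp[OF continuous_map_pullback_fst snd_real])+)

  let ?TI = "prod_topology ?T ?I"
  \<comment> \<open>The end point map is continuous because it occurs in the base component of the comparison map of \<open>K\<close>.\<close>
  have endpoints_c: "continuous_map ?T (reach_space X) endpoints"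
  proof -
    have "continuous_map ?TI (pullback_space ?B (homotopy_square K) ?T endpoints)
        (\<lambda>(\<sigma>, t). ((endpoints \<sigma>, t), trace_map X (\<lambda>x. K (x, t)) \<sigma>))"
      using cK unfolding coherently_psp_homotopy_def fibre_homotopy_equivalence_def fibre_map_def by blast
    from continuous_map_comp[OF this continuous_map_pullback_fst]
    have "continuous_map ?TI ?B (\<lambda>z. (endpoints (fst z), snd z))" by (simp add: case_prod_unfold)
    from continuous_map_comp[OF this[unfolded reach_base_eq] continuous_map_fst]
    have c: "continuous_map ?TI (reach_space X) (\<lambda>z. endpoints (fst z))" by simp
    have "continuous_map ?T ?TI (\<lambda>\<sigma>. (\<sigma>, 0))"
      by (intro continuous_map_pairedI) auto
    from continuous_map_comp[OF this c] show ?thesis by simp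
  qed
  have "fibre_homotopy_equivalence ?TI (\<lambda>(\<sigma>, t). (endpoints \<sigma>, t)) ?E fst (\<lambda>z. ((endpoints (fst z), snd z), fst z))"
  proof (rule fibre_homeomorphism_imp_equivalence[where g = "\<lambda>z. (snd z, snd (fst z))"])
    show "fibre_map ?TI (\<lambda>(\<sigma>, t). (endpoints \<sigma>, t)) ?E fst (\<lambda>z. ((endpoints (fst z), snd z), fst z))"
      unfolding fibre_map_def reach_base_eq
      by (auto intro!: continuous_map_into_pullback_space continuous_map_pairedI continuous_map_fst
            continuous_map_snd continuous_map_comp[OF continuous_map_fst endpoints_c])
    show "fibre_map ?E fst ?TI (\<lambda>(\<sigma>, t). (endpoints \<sigma>, t)) (\<lambda>z. (snd z, snd (fst z)))"
      unfolding fibre_map_def reach_base_eq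
      by (auto simp: topspace_pullback_space intro!: continuous_map_pairedI continuous_map_pullback_snd
            continuous_map_comp[OF continuous_map_pullback_fst continuous_map_snd])
  qed (auto simp: topspace_pullback_space)
  from fibre_homotopy_equivalence_comp[OF this F]
  have "fibre_homotopy_equivalence ?TI (\<lambda>(\<sigma>, t). (endpoints \<sigma>, t)) ?E' fst
      (\<lambda>(\<sigma>, t). ((endpoints \<sigma>, t), trace_map X (\<lambda>x. H (x, t)) \<sigma>))"
    by (simp add: o_def case_prod_unfold)
  then show ?thesis
    unfolding coherently_psp_homotopy_def using H_psp_homotopy by blast
qed

end

theorem lemma2p9:
  fixes X :: "'a dstruct" and g h :: "'a \<Rightarrow> 'a"
  assumes "d_space X" and "dmap X X g" and "dmap X X h"
  shows "(zero_inessential X (h \<circ> g) \<and> zero_inessential X h \<longrightarrow> zero_inessential X g) \<and>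
         (coherently_zero_inessential X (h \<circ> g) \<and> coherently_zero_inessential X h \<longrightarrow>
            coherently_zero_inessential X g)"
proof (intro conjI impI; elim conjE)
  assume "zero_inessential X (h \<circ> g)" "zero_inessential X h"
  then obtain K L where "homotopies_to_composite X g h K L"
    using assms unfolding zero_inessential_def homotopies_to_composite_def by fastforce
  then show "zero_inessential X g"
    using assms(2) homotopies_to_composite.H_psp_homotopy homotopies_to_composite.H_ends unfolding zero_inessential_def by metis
next
  assume "coherently_zero_inessential X (h \<circ> g)" "coherently_zero_inessential X h"
  then obtain K L where KL: "homotopies_to_composite X g h K L"
      "coherently_psp_homotopy X K" "coherently_psp_homotopy X L"
    using assms unfolding coherently_zero_inessential_def homotopies_to_composite_def coherently_psp_homotopy_def by fastforce
  then show "coherently_zero_inessential X g"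
    using assms(2) homotopies_to_composite.H_coherent homotopies_to_composite.H_ends unfolding coherently_zero_inessential_def by metis
qed

end
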